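(* Consider the problem $\min_{x\in\mathcal{X}}\mu(x)$, where $\mu$ is a Gaussian process posterior mean and $\mathcal{X}$ is a hyperrectangle, and consider a spatial branch-and-bound algorithm using the PALM-Mean node lower bounds $\mathrm{LB}^{\mathrm{PALM}}(X_h)$ (all defined in the context). Assume that each node lower-bounding problem is solved to global optimality up to the prescribed numerical tolerance, that node upper bounds are computed from feasible evaluations of the true posterior mean $\mu$, and that the branching rule generates a sequence of nested boxes whose diameters converge to zero along every infinite branch. A spatial branch-and-bound algorithm satisfying these assumptions terminates with an $\varepsilon$-global minimizer of $\min_{x\in\mathcal{X}}\mu(x)$, up to the solver tolerances used in the node subproblems.
   Context: Gaussian process posterior mean. The training inputs $x_1,\ldots,x_N\in\mathbb{R}^D$, observations $y\in\mathbb{R}^N$ (centered, so that the prior mean is zero), noise variance $\sigma_\epsilon^2$, and kernel hyperparameters $\sigma_f^2>0$ and $L=\mathrm{diag}(\ell_1,\ldots,\ell_D)$ with all $\ell_j>0$ are fixed. Put $r_i(x):=\|L^{-1}(x-x_i)\|_2$ and $d_i(x):=r_i(x)^2$. The kernel is stationary and monotonically nonincreasing in scaled distance; it is one of the following, with $k_i(x):=k(x,x_i)=\kappa(\zeta_i(x))$, where $\zeta_i(x):=d_i(x)$ for RBF and $\zeta_i(x):=r_i(x)$ for Matérn: - RBF: $\kappa(d)=\sigma_f^2e^{-d/2}$; - Matérn-$1/2$: $\kappa(r)=\sigma_f^2e^{-r}$; - Matérn-$3/2$: $\kappa(r)=\sigma_f^2(1+\sqrt3\,r)e^{-\sqrt3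 r}$; - Matérn-$5/2$: $\kappa(r)=\sigma_f^2(1+\sqrt5\,r+\tfrac53r^2)e^{-\sqrt5 r}$. The posterior mean is $\mu(x)=\sum_{i=1}^N\alpha_ik_i(x)$ with $\alpha=(K_{XX}+\sigma_\epsilon^2I)^{-1}y$, $K_{XX}=[k(x_i,x_j)]_{i,j}$. Put $\alpha_i^+:=\max\{0,\alpha_i\}$, $\alpha_i^-:=\max\{0,-\alpha_i\}$. The domain is $\mathcal{X}=[x^L,x^U]\subset\mathbb{R}^D$ with $x^L<x^U$ componentwise. A node is a hyperrectangle $X_h=[x_h^L,x_h^U]\subseteq\mathcal{X}$. Analytical bounds. For a node $X_h$, let $\Delta^{\mathrm{near}}_{i,h,j}$ be the distance from $x_{i,j}$ to $[x_{h,j}^L,x_{h,j}^U]$ and $\Delta^{\mathrm{far}}_{i,h,j}:=\max\{|x_{h,j}^L-x_{i,j}|,|x_{h,j}^U-x_{i,j}|\}$. Set $r_{i,h}^L=\big(\sum_j(\Delta^{\mathrm{near}}_{i,h,j})^2/\ell_j^2\big)^{1/2}$ and $r_{i,h}^U=\big(\sum_j(\Delta^{\mathrm{far}}_{i,h,j})^2/\ell_j^2\big)^{1/2}$. Let $[\zeta_{i,h}^L,\zeta_{i,h}^U]$ be $[(r_{i,h}^L)^2,(r_{i,h}^U)^2]$ for RBF and $[r_{i,h}^L,r_{i,h}^U]$ for Matérn. Define $\underline{k}_{i,h}^{A}:=\kappa(\zeta_{i,h}^U)$, $\overline{k}_{i,h}^{A}:=\kappa(\zeta_{i,h}^L)$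 and $\underline{t}_{i,h}^{A}:=\alpha_i^+\underline{k}_{i,h}^{A}-\alpha_i^-\overline{k}_{i,h}^{A}$. Important and unimportant terms. With $\beta_{i,h}:=\max_{x\in X_h}|\alpha_ik_i(x)|$ and a specified threshold $\rho\in[0,1]$, let $\mathcal{I}(h):=\{i:\beta_{i,h}\ge\rho\}$ and $\mathcal{U}(h):=\{1,\ldots,N\}\setminus\mathcal{I}(h)$. Piecewise-linear envelopes. For each $i\in\mathcal{I}(h)$ choose breakpoints $\zeta_{i,h}^L=\eta_{i,0}<\eta_{i,1}<\cdots<\eta_{i,S_i}=\zeta_{i,h}^U$. For Matérn-$3/2$ and Matérn-$5/2$, the inflection point of $\kappa$ ($1/\sqrt3$ and $(1+\sqrt5)/(2\sqrt5)$, respectively) is inserted into the breakpoint set whenever it lies inside the interval; $\kappa$ is concave before it and convex after it. For RBF and Matérn-$1/2$, $\kappa$ is convex on $[0,\infty)$. On a segment $[\eta_{i,s-1},\eta_{i,s}]$ let $u_{i,s}$ be the secant line of $\kappa$ through the two endpoints, and let the tangent envelope be $\ell_{i,s}(\zeta):=\max\{\kappa(\eta_{i,s-1})+\kappa'(\eta_{i,s-1})(\zeta-\eta_{i,s-1}),\ \kappa(\eta_{i,s})+\kappa'(\eta_{i,s})(\zeta-\eta_{i,s})\}$. On segments where $\kappa$ is convex, the lower envelope $\underline{\kappa}^P_{i,s}$ is $\ell_{i,s}$ and the upper envelope $\overline{\kappa}^P_{i,s}$ is $u_{i,s}$; on segments where $\kappa$ is concave these roles are reversed. For $x\in X_h$,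 $\underline{k}_{i,h}^{P}(x)$ and $\overline{k}_{i,h}^{P}(x)$ are the values at $\zeta_i(x)$ of the lower and upper envelopes of the segment containing $\zeta_i(x)$, so that $\underline{k}_{i,h}^{P}(x)\le k_i(x)\le\overline{k}_{i,h}^{P}(x)$. PALM-Mean lower estimator and node lower bound: \[ \underline{\mu}_h^{\mathrm{PALM}}(x):=\sum_{i\in\mathcal{I}(h)}\left(\alpha_i^+\underline{k}_{i,h}^{P}(x)-\alpha_i^-\overline{k}_{i,h}^{P}(x)\right)+\sum_{i\in\mathcal{U}(h)}\underline{t}_{i,h}^{A},\qquad \mathrm{LB}^{\mathrm{PALM}}(X_h):=\min_{x\in X_h}\underline{\mu}_h^{\mathrm{PALM}}(x). \] The node lower-bounding problem is the minimization defining $\mathrm{LB}^{\mathrm{PALM}}(X_h)$. Spatial branch-and-bound. The algorithm keeps a list of active nodes, starting from $\mathcal{X}$ (or a collection of subboxes of it), and an incumbent, i.e. the best feasible point found so far, with objective value $\mathrm{UB}^\star$. On each node it solves the node lower-bounding problem and computes an upper bound $\mu(\hat{x}_h)$ at some feasible $\hat{x}_h\in X_h$ (obtained by local optimization of $\mu$), updating the incumbent if improved. A node may be discarded (fathomed) whenever its lower bound is at least $\mathrm{UB}^\star-\varepsilon$, where $\varepsilon>0$ is the chosen optimality tolerance; a node that is not fathomed is branched on one coordinate into child boxes. The algorithm stops when the gap between $\mathrm{UB}^\star$ and the global lower bound meets the requested absolute or relative tolerance, and returns the incumbent. An infinite branch is an infinite sequence of nodes each of which is a child of the preceding one. An $\varepsilon$-global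 minimizer is a point of $\mathcal{X}$ whose objective value is within the requested tolerance $\varepsilon$ of the global minimum of $\mu$ over $\mathcal{X}$.
   Formalization: The numerical tolerance by which a node lower-bounding problem may be underestimated is assumed strictly smaller than the optimality tolerance ε; otherwise, e.g. for y = 0, no node need ever be fathomed and the algorithm need not terminate. *)

theory Defs
  imports "HOL-Analysis.Analysis"
begin

datatype kernel = RBF | Matern12 | Matern32 | Matern52

text \<open>The radial profile takes the squared scaled distance for \<open>RBF\<close> and the scaled distance
  for the Matern kernels (see \<open>zeta_arg\<close>). It is defined on all reals by the same formula, so
  that \<open>deriv\<close> at \<open>0\<close> is the (one-sided) derivative of the profile there.\<close>

fun kappa :: "kernel \<Rightarrow> real \<Rightarrow> real \<Rightarrow> real" where
  "kappa RBF s d = s * exp (- d / 2)"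
| "kappa Matern12 s r = s * exp (- r)"
| "kappa Matern32 s r = s * (1 + sqrt 3 * r) * exp (- sqrt 3 * r)"
| "kappa Matern52 s r = s * (1 + sqrt 5 * r + 5 / 3 * r\<^sup>2) * exp (- sqrt 5 * r)"

fun zeta_arg :: "kernel \<Rightarrow> real \<Rightarrow> real" where
  "zeta_arg RBF r = r\<^sup>2"
| "zeta_arg _ r = r"

fun inflection_points :: "kernel \<Rightarrow> real set" where
  "inflection_points Matern32 = {1 / sqrt 3}"
| "inflection_points Matern52 = {(1 + sqrt 5) / (2 * sqrt 5)}"
| "inflection_points _ = {}"

record ('n, 'd) gp =
  kern :: kernel
  sigf2 :: real
  noise2 :: real
  scales :: "real ^ 'd"
  inputs :: "'n \<Rightarrow> real ^ 'd"
  obs :: "real ^ 'n"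
  dom_lo :: "real ^ 'd"
  dom_hi :: "real ^ 'd"

definition valid_gp :: "('n::finite, 'd::finite) gp \<Rightarrow> bool" where
  "valid_gp G \<longleftrightarrow> 0 < sigf2 G \<and> 0 \<le> noise2 G \<and> (\<forall>j. 0 < scales G $ j)
     \<and> (\<forall>j. dom_lo G $ j < dom_hi G $ j)"

definition domain :: "('n::finite, 'd::finite) gp \<Rightarrow> (real ^ 'd) set" where
  "domain G = cbox (dom_lo G) (dom_hi G)"

definition scaled_dist :: "('n::finite, 'd::finite) gp \<Rightarrow> real ^ 'd \<Rightarrow> real ^ 'd \<Rightarrow> real" where
  "scaled_dist G x x' = norm (\<chi> j. (x $ j - x' $ j) / scales G $ j)"

definition zeta :: "('n::finite, 'd::finite) gp \<Rightarrow> 'n \<Rightarrow> real ^ 'd \<Rightarrow> real" where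
  "zeta G i x = zeta_arg (kern G) (scaled_dist G x (inputs G i))"

definition kprof :: "('n::finite, 'd::finite) gp \<Rightarrow> real \<Rightarrow> real" where
  "kprof G = kappa (kern G) (sigf2 G)"

definition kval :: "('n::finite, 'd::finite) gp \<Rightarrow> 'n \<Rightarrow> real ^ 'd \<Rightarrow> real" where
  "kval G i x = kprof G (zeta G i x)"

definition gram :: "('n::finite, 'd::finite) gp \<Rightarrow> real ^ 'n ^ 'n" where
  "gram G = (\<chi> i j. kval G j (inputs G i))"

definition alpha :: "('n::finite, 'd::finite) gp \<Rightarrow> real ^ 'n" where
  "alpha G = matrix_inv (gram G + mat (noise2 G)) *v obs G"

definition alpha_pos :: "('n::finite, 'd::finite) gp \<Rightarrow> 'n \<Rightarrow> real" where
  "alpha_pos G i = max 0 (alpha G $ i)"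

definition alpha_neg :: "('n::finite, 'd::finite) gp \<Rightarrow> 'n \<Rightarrow> real" where
  "alpha_neg G i = max 0 (- alpha G $ i)"

definition post_mean :: "('n::finite, 'd::finite) gp \<Rightarrow> real ^ 'd \<Rightarrow> real" where
  "post_mean G x = (\<Sum>i\<in>UNIV. alpha G $ i * kval G i x)"

type_synonym 'd box = "(real ^ 'd) \<times> (real ^ 'd)"

definition pts :: "'d::finite box \<Rightarrow> (real ^ 'd) set" where
  "pts B = cbox (fst B) (snd B)"

definition is_node :: "('n::finite, 'd::finite) gp \<Rightarrow> 'd box \<Rightarrow> bool" where
  "is_node G B \<longleftrightarrow> (\<forall>j. fst B $ j < snd B $ j) \<and> pts B \<subseteq> domain G"

definition near_dist :: "('n::finite, 'd::finite) gp \<Rightarrow> 'd box \<Rightarrow> 'n \<Rightarrow> 'd \<Rightarrow> real" where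
  "near_dist G B i j = infdist (inputs G i $ j) {fst B $ j .. snd B $ j}"

definition far_dist :: "('n::finite, 'd::finite) gp \<Rightarrow> 'd box \<Rightarrow> 'n \<Rightarrow> 'd \<Rightarrow> real" where
  "far_dist G B i j = max \<bar>fst B $ j - inputs G i $ j\<bar> \<bar>snd B $ j - inputs G i $ j\<bar>"

definition zeta_lo :: "('n::finite, 'd::finite) gp \<Rightarrow> 'd box \<Rightarrow> 'n \<Rightarrow> real" where
  "zeta_lo G B i =
     zeta_arg (kern G) (sqrt (\<Sum>j\<in>UNIV. (near_dist G B i j)\<^sup>2 / (scales G $ j)\<^sup>2))"

definition zeta_hi :: "('n::finite, 'd::finite) gp \<Rightarrow> 'd box \<Rightarrow> 'n \<Rightarrow> real" where
  "zeta_hi G B i =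
     zeta_arg (kern G) (sqrt (\<Sum>j\<in>UNIV. (far_dist G B i j)\<^sup>2 / (scales G $ j)\<^sup>2))"

definition term_lo :: "('n::finite, 'd::finite) gp \<Rightarrow> 'd box \<Rightarrow> 'n \<Rightarrow> real" where
  "term_lo G B i =
     alpha_pos G i * kprof G (zeta_hi G B i) - alpha_neg G i * kprof G (zeta_lo G B i)"

definition important :: "('n::finite, 'd::finite) gp \<Rightarrow> real \<Rightarrow> 'd box \<Rightarrow> 'n set" where
  "important G \<rho> B = {i. (SUP x\<in>pts B. \<bar>alpha G $ i * kval G i x\<bar>) \<ge> \<rho>}"

text \<open>Breakpoints are given by the strictly increasing list \<open>[\<eta>\<^sub>0, \<dots>, \<eta>\<^sub>S]\<close> with \<open>S \<ge> 1\<close>.\<close>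

definition valid_breakpoints ::
  "('n::finite, 'd::finite) gp \<Rightarrow> 'd box \<Rightarrow> 'n \<Rightarrow> real list \<Rightarrow> bool" where
  "valid_breakpoints G B i \<eta> \<longleftrightarrow>
     2 \<le> length \<eta> \<and> sorted_wrt (<) \<eta> \<and> hd \<eta> = zeta_lo G B i \<and> last \<eta> = zeta_hi G B i
     \<and> inflection_points (kern G) \<inter> {zeta_lo G B i .. zeta_hi G B i} \<subseteq> set \<eta>"

definition secant :: "(real \<Rightarrow> real) \<Rightarrow> real \<Rightarrow> real \<Rightarrow> real \<Rightarrow> real" where
  "secant f a b z = f a + (f b - f a) / (b - a) * (z - a)"

definition tangent_env :: "(real \<Rightarrow> real) \<Rightarrow> real \<Rightarrow> real \<Rightarrow> real \<Rightarrow> real" where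
  "tangent_env f a b z = max (f a + deriv f a * (z - a)) (f b + deriv f b * (z - b))"

text \<open>Since the inflection points are breakpoints, the profile is concave on every segment on which
  it is not convex; there the two envelopes swap roles. The maximum of the two tangents is kept
  in this case as well: each tangent of a concave function is a valid upper bound.\<close>

definition lower_env :: "(real \<Rightarrow> real) \<Rightarrow> real \<Rightarrow> real \<Rightarrow> real \<Rightarrow> real" where
  "lower_env f a b = (if convex_on {a..b} f then tangent_env f a b else secant f a b)"

definition upper_env :: "(real \<Rightarrow> real) \<Rightarrow> real \<Rightarrow> real \<Rightarrow> real \<Rightarrow> real" where
  "upper_env f a b = (if convex_on {a..b} f then secant f a b else tangent_env f a b)"

text \<open>An interior breakpoint belongs to two segments, whose envelopes need not agree there (namely for
  the upper envelope on concave segments). The weaker of the two values is used, as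
  in a formulation where the segment is itself a decision variable; this makes the lower
  estimator below lower semicontinuous, so that its minimum over a box is attained.\<close>

definition segments_at :: "real list \<Rightarrow> real \<Rightarrow> nat set" where
  "segments_at \<eta> z = {s. Suc s < length \<eta> \<and> \<eta> ! s \<le> z \<and> z \<le> \<eta> ! Suc s}"

definition kpl_lo ::
  "('n::finite, 'd::finite) gp \<Rightarrow> real list \<Rightarrow> 'n \<Rightarrow> real ^ 'd \<Rightarrow> real" where
  "kpl_lo G \<eta> i x =
     Min ((\<lambda>s. lower_env (kprof G) (\<eta> ! s) (\<eta> ! Suc s) (zeta G i x)) ` segments_at \<eta> (zeta G i x))"

definition kpl_hi ::
  "('n::finite, 'd::finite) gp \<Rightarrow> real list \<Rightarrow> 'n \<Rightarrow> real ^ 'd \<Rightarrow> real" where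
  "kpl_hi G \<eta> i x =
     Max ((\<lambda>s. upper_env (kprof G) (\<eta> ! s) (\<eta> ! Suc s) (zeta G i x)) ` segments_at \<eta> (zeta G i x))"

definition palm_mean ::
  "('n::finite, 'd::finite) gp \<Rightarrow> real \<Rightarrow> 'd box \<Rightarrow> ('n \<Rightarrow> real list) \<Rightarrow> real ^ 'd \<Rightarrow> real" where
  "palm_mean G \<rho> B \<eta> x =
     (\<Sum>i\<in>important G \<rho> B. alpha_pos G i * kpl_lo G (\<eta> i) i x - alpha_neg G i * kpl_hi G (\<eta> i) i x)
     + (\<Sum>i\<in>UNIV - important G \<rho> B. term_lo G B i)"

definition palm_LB ::
  "('n::finite, 'd::finite) gp \<Rightarrow> real \<Rightarrow> 'd box \<Rightarrow> ('n \<Rightarrow> real list) \<Rightarrow> real" where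
  "palm_LB G \<rho> B \<eta> = (INF x\<in>pts B. palm_mean G \<rho> B \<eta> x)"

text \<open>\<open>tol_abs\<close> is the optimality tolerance \<open>\<epsilon>\<close>, used for fathoming and in the absolute gap test;
  \<open>tol_rel\<close> is the relative gap tolerance (\<open>0\<close> if only the absolute test is used).
  A node problem with optimal value \<open>v\<close> is reported as some number
  in \<open>[v - solver_below, v + solver_above]\<close>.\<close>

record bb_params =
  threshold :: real
  tol_abs :: real
  tol_rel :: real
  solver_below :: real
  solver_above :: real

text \<open>An underestimation of node optima by \<open>\<epsilon>\<close> or more would defeat the fathoming test on
  arbitrarily small boxes, hence \<open>solver_below < tol_abs\<close>.\<close>

definition valid_params :: "bb_params \<Rightarrow> bool" where
  "valid_params P \<longleftrightarrow> 0 \<le> threshold P \<and> threshold P \<le> 1 \<and> 0 < tol_abs P \<and> 0 \<le> tol_rel P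
     \<and> 0 \<le> solver_below P \<and> solver_below P < tol_abs P \<and> 0 \<le> solver_above P"

text \<open>Until its node problem has been solved, an active node carries the lower bound inherited from
  its parent (\<open>-\<infinity>\<close> for the initial nodes).\<close>

record 'd active_node =
  node_box :: "'d box"
  solved :: bool
  bound :: ereal

record 'd bb_state =
  active :: "'d active_node set"
  incumbent :: "(real ^ 'd) option"

definition upper_bound :: "('n::finite, 'd::finite) gp \<Rightarrow> 'd bb_state \<Rightarrow> ereal" where
  "upper_bound G s = (case incumbent s of None \<Rightarrow> \<infinity> | Some x \<Rightarrow> ereal (post_mean G x))"

text \<open>The incumbent value is included because the discarded nodes leave no other trace; with no
  active node left the gap is \<open>0\<close>.\<close>

definition global_lower_bound :: "('n::finite, 'd::finite) gp \<Rightarrow> 'd bb_state \<Rightarrow> ereal" where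
  "global_lower_bound G s = Min (insert (upper_bound G s) (bound ` active s))"

definition gap_tolerance ::
  "('n::finite, 'd::finite) gp \<Rightarrow> bb_params \<Rightarrow> real ^ 'd \<Rightarrow> real" where
  "gap_tolerance G P x = max (tol_abs P) (tol_rel P * \<bar>post_mean G x\<bar>)"

definition bb_stopped :: "('n::finite, 'd::finite) gp \<Rightarrow> bb_params \<Rightarrow> 'd bb_state \<Rightarrow> bool" where
  "bb_stopped G P s \<longleftrightarrow> (\<exists>x. incumbent s = Some x
     \<and> upper_bound G s - global_lower_bound G s \<le> ereal (gap_tolerance G P x))"

definition fathomable ::
  "('n::finite, 'd::finite) gp \<Rightarrow> bb_params \<Rightarrow> 'd bb_state \<Rightarrow> 'd active_node \<Rightarrow> bool" where
  "fathomable G P s a \<longleftrightarrow> bound a \<ge> upper_bound G s - ereal (tol_abs P)"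

definition bb_init :: "('n::finite, 'd::finite) gp \<Rightarrow> 'd bb_state \<Rightarrow> bool" where
  "bb_init G s \<longleftrightarrow> incumbent s = None \<and>
     (\<exists>\<B>. finite \<B> \<and> (\<forall>B\<in>\<B>. is_node G B) \<and> \<Union> (pts ` \<B>) = domain G
        \<and> active s = (\<lambda>B. \<lparr>node_box = B, solved = False, bound = -\<infinity>\<rparr>) ` \<B>)"

definition solve_step ::
  "('n::finite, 'd::finite) gp \<Rightarrow> bb_params \<Rightarrow> 'd bb_state \<Rightarrow> 'd bb_state \<Rightarrow> bool" where
  "solve_step G P s s' \<longleftrightarrow> (\<exists>a \<eta> lb xh. a \<in> active s \<and> \<not> solved a
     \<and> (\<forall>i\<in>important G (threshold P) (node_box a). valid_breakpoints G (node_box a) i (\<eta> i))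
     \<and> palm_LB G (threshold P) (node_box a) \<eta> - solver_below P \<le> lb
     \<and> lb \<le> palm_LB G (threshold P) (node_box a) \<eta> + solver_above P
     \<and> xh \<in> pts (node_box a)
     \<and> s' = \<lparr>active = insert (a\<lparr>solved := True, bound := ereal lb\<rparr>) (active s - {a}),
            incumbent = (if ereal (post_mean G xh) < upper_bound G s then Some xh
                         else incumbent s)\<rparr>)"

definition fathom_step ::
  "('n::finite, 'd::finite) gp \<Rightarrow> bb_params \<Rightarrow> 'd bb_state \<Rightarrow> 'd bb_state \<Rightarrow> bool" where
  "fathom_step G P s s' \<longleftrightarrow>
     (\<exists>a\<in>active s. fathomable G P s a \<and> s' = s\<lparr>active := active s - {a}\<rparr>)"

text \<open>Coordinate \<open>j\<close> is cut at \<open>c 0 < \<dots> < c m\<close> into \<open>m \<ge> 2\<close> pieces.\<close>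

definition box_split :: "'d::finite box \<Rightarrow> 'd box set \<Rightarrow> bool" where
  "box_split B \<C> \<longleftrightarrow> (\<exists>j (m::nat) c. 2 \<le> m \<and> c 0 = fst B $ j \<and> c m = snd B $ j
     \<and> (\<forall>k<m. c k < c (Suc k))
     \<and> \<C> = (\<lambda>k. (\<chi> i. if i = j then c k else fst B $ i,
                 \<chi> i. if i = j then c (Suc k) else snd B $ i)) ` {..<m})"

definition branch_step ::
  "('n::finite, 'd::finite) gp \<Rightarrow> bb_params \<Rightarrow> 'd box \<Rightarrow> 'd box set
     \<Rightarrow> 'd bb_state \<Rightarrow> 'd bb_state \<Rightarrow> bool" where
  "branch_step G P B \<C> s s' \<longleftrightarrow> (\<exists>a\<in>active s. node_box a = B \<and> solved a \<and> \<not> fathomable G P s a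
     \<and> box_split B \<C>
     \<and> s' = s\<lparr>active := (active s - {a})
                 \<union> (\<lambda>C. \<lparr>node_box = C, solved = False, bound = bound a\<rparr>) ` \<C>\<rparr>)"

definition bb_step ::
  "('n::finite, 'd::finite) gp \<Rightarrow> bb_params \<Rightarrow> 'd bb_state \<Rightarrow> 'd bb_state \<Rightarrow> bool" where
  "bb_step G P s s' \<longleftrightarrow> \<not> bb_stopped G P s
     \<and> (solve_step G P s s' \<or> fathom_step G P s s' \<or> (\<exists>B \<C>. branch_step G P B \<C> s s'))"

text \<open>A complete execution \<open>S 0, S 1, \<dots>\<close> with \<open>T\<close> steps, where \<open>T = \<infinity>\<close> is allowed. A finite
  one ends only in a state from which no step is possible; values of \<open>S\<close> beyond \<open>T\<close> are
  irrelevant. Node selection, breakpoints, candidate points and splits are arbitrary.\<close>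

definition bb_execution ::
  "('n::finite, 'd::finite) gp \<Rightarrow> bb_params \<Rightarrow> (nat \<Rightarrow> 'd bb_state) \<Rightarrow> enat \<Rightarrow> bool" where
  "bb_execution G P S T \<longleftrightarrow> bb_init G (S 0)
     \<and> (\<forall>n. enat n < T \<longrightarrow> bb_step G P (S n) (S (Suc n)))
     \<and> (\<forall>n. T = enat n \<longrightarrow> (\<nexists>s'. bb_step G P (S n) s'))"

definition child_in ::
  "('n::finite, 'd::finite) gp \<Rightarrow> bb_params \<Rightarrow> (nat \<Rightarrow> 'd bb_state) \<Rightarrow> enat
     \<Rightarrow> 'd box \<Rightarrow> 'd box \<Rightarrow> bool" where
  "child_in G P S T B C \<longleftrightarrow>
     (\<exists>n \<C>. enat n < T \<and> branch_step G P B \<C> (S n) (S (Suc n)) \<and> \<not> bb_stopped G P (S n) \<and> C \<in> \<C>)"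

definition infinite_branch ::
  "('n::finite, 'd::finite) gp \<Rightarrow> bb_params \<Rightarrow> (nat \<Rightarrow> 'd bb_state) \<Rightarrow> enat
     \<Rightarrow> (nat \<Rightarrow> 'd box) \<Rightarrow> bool" where
  "infinite_branch G P S T b \<longleftrightarrow> (\<forall>k. child_in G P S T (b k) (b (Suc k)))"

definition eps_global_minimizer ::
  "('a \<Rightarrow> real) \<Rightarrow> 'a set \<Rightarrow> real \<Rightarrow> 'a \<Rightarrow> bool" where
  "eps_global_minimizer f X e x \<longleftrightarrow> x \<in> X \<and> f x \<le> (INF z\<in>X. f z) + e"

end

theory Submission
  imports Defs "HOL-Library.Multiset"
begin

text \<open>The profile and all of its envelopes are Lipschitz on the attainable range of
  \<open>zeta\<close>, so over a node the PALM estimator differs from the posterior mean by at most a constant times the widths of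
  the intervals \<open>[zeta_lo, zeta_hi]\<close>. The end points of these intervals are attained
  on the node, hence by uniform continuity of \<open>zeta\<close> the widths vanish with the diameter. A
  branched node is solved and not fathomable, so its bound stays at least
  \<open>tol_abs - solver_below > 0\<close> away from \<open>post_mean\<close> at its candidate point; along an infinite branch
  this contradicts the convergence of the bounds. The child relation is therefore
  well-founded, and every step strictly decreases the set of active nodes in the induced multiset
  order, so the run is finite. On termination each point of the domain lies in an active node with a
  valid bound or was discarded with a bound close to the incumbent value.\<close>

section \<open>Kernel profiles\<close>

fun dkappa :: "kernel \<Rightarrow> real \<Rightarrow> real \<Rightarrow> real" where
  "dkappa RBF s z = - (s / 2) * exp (- z / 2)"
| "dkappa Matern12 s z = - s * exp (- z)"
| "dkappa Matern32 s z = - 3 * s * z * exp (- sqrt 3 * z)"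
| "dkappa Matern52 s z = - (5 / 3) * s * (z + sqrt 5 * z\<^sup>2) * exp (- sqrt 5 * z)"

fun ddkappa :: "kernel \<Rightarrow> real \<Rightarrow> real \<Rightarrow> real" where
  "ddkappa RBF s z = s / 4 * exp (- z / 2)"
| "ddkappa Matern12 s z = s * exp (- z)"
| "ddkappa Matern32 s z = 3 * s * (sqrt 3 * z - 1) * exp (- sqrt 3 * z)"
| "ddkappa Matern52 s z = 5 / 3 * s * (5 * z\<^sup>2 - sqrt 5 * z - 1) * exp (- sqrt 5 * z)"

text \<open>The derivative is two-sided at every real, 0 included, because the profile is extended
  to negative arguments by the same formula. So \<open>deriv\<close> in the tangents takes the
  intended value even at a left end point 0.\<close>

lemma DERIV_kappa: "(kappa k s has_real_derivative dkappa k s z) (at z)"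
proof (cases k)
  case RBF
  have "((\<lambda>z. s * exp (- z / 2)) has_real_derivative - (s / 2) * exp (- z / 2)) (at z)"
    by (auto intro!: derivative_eq_intros)
  moreover have "kappa RBF s = (\<lambda>z. s * exp (- z / 2))" by auto
  ultimately show ?thesis using RBF by simp
next
  case Matern12
  have "((\<lambda>z. s * exp (- z)) has_real_derivative - s * exp (- z)) (at z)"
    by (auto intro!: derivative_eq_intros)
  moreover have "kappa Matern12 s = (\<lambda>z. s * exp (- z))" by auto
  ultimately show ?thesis using Matern12 by simp
next
  case Matern32
  have "((\<lambda>z. s * (1 + sqrt 3 * z) * exp (- sqrt 3 * z)) has_real_derivative
      - 3 * s * z * exp (- sqrt 3 * z)) (at z)"
    by (auto intro!: derivative_eq_intros simp: algebra_simps)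
  moreover have "kappa Matern32 s = (\<lambda>z. s * (1 + sqrt 3 * z) * exp (- sqrt 3 * z))" by auto
  ultimately show ?thesis using Matern32 by simp
next
  case Matern52
  have "((\<lambda>z. s * (1 + sqrt 5 * z + 5 / 3 * z\<^sup>2) * exp (- sqrt 5 * z)) has_real_derivative
      - (5 / 3) * s * (z + sqrt 5 * z\<^sup>2) * exp (- sqrt 5 * z)) (at z)"
    by (auto intro!: derivative_eq_intros simp: field_simps power2_eq_square)
  moreover have "kappa Matern52 s = (\<lambda>z. s * (1 + sqrt 5 * z + 5 / 3 * z\<^sup>2) * exp (- sqrt 5 * z))"
    by auto
  ultimately show ?thesis using Matern52 by simp
qed

lemma DERIV_dkappa: "(dkappa k s has_real_derivative ddkappa k s z) (at z)"
proof (cases k)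
  case RBF
  have "((\<lambda>z. - (s / 2) * exp (- z / 2)) has_real_derivative s / 4 * exp (- z / 2)) (at z)"
    by (auto intro!: derivative_eq_intros)
  moreover have "dkappa RBF s = (\<lambda>z. - (s / 2) * exp (- z / 2))" by auto
  ultimately show ?thesis using RBF by simp
next
  case Matern12
  have "((\<lambda>z. - s * exp (- z)) has_real_derivative s * exp (- z)) (at z)"
    by (auto intro!: derivative_eq_intros)
  moreover have "dkappa Matern12 s = (\<lambda>z. - s * exp (- z))" by auto
  ultimately show ?thesis using Matern12 by simp
next
  case Matern32
  have "((\<lambda>z. - 3 * s * z * exp (- sqrt 3 * z)) has_real_derivative
      3 * s * (sqrt 3 * z - 1) * exp (- sqrt 3 * z)) (at z)"
    by (auto intro!: derivative_eq_intros simp: algebra_simps)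
  moreover have "dkappa Matern32 s = (\<lambda>z. - 3 * s * z * exp (- sqrt 3 * z))" by auto
  ultimately show ?thesis using Matern32 by simp
next
  case Matern52
  have "((\<lambda>z. - (5 / 3) * s * (z + sqrt 5 * z\<^sup>2) * exp (- sqrt 5 * z)) has_real_derivative
      5 / 3 * s * (5 * z\<^sup>2 - sqrt 5 * z - 1) * exp (- sqrt 5 * z)) (at z)"
    by (auto intro!: derivative_eq_intros simp: field_simps power2_eq_square)
  moreover have "dkappa Matern52 s = (\<lambda>z. - (5 / 3) * s * (z + sqrt 5 * z\<^sup>2) * exp (- sqrt 5 * z))"
    by auto
  ultimately show ?thesis using Matern52 by simp
qed

lemma deriv_kappa: "deriv (kappa k s) = dkappa k s"
  using DERIV_imp_deriv[OF DERIV_kappa] by blast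

lemma continuous_on_dkappa: "continuous_on A (dkappa k s)"
  by (rule DERIV_continuous_on[OF has_field_derivative_at_within[OF DERIV_dkappa]])

text \<open>The second derivative is an exponential times a factor that is positive for
  \<open>RBF\<close> and \<open>Matern12\<close>, linear with root p for \<open>Matern32\<close>,
  and quadratic with roots p and - q for \<open>Matern52\<close>. Since q > 0, on nonnegative
  arguments the sign can change only at the inflection point p.\<close>

lemma ddkappa_sign:
  assumes "0 < s" and "0 \<le> a" and no_inflection: "inflection_points k \<inter> {a<..<b} = {}"
  shows "(\<forall>z\<in>{a..b}. 0 \<le> ddkappa k s z) \<or> (\<forall>z\<in>{a..b}. ddkappa k s z \<le> 0)"
proof (cases k)
  case Matern32
  define p :: real where "p = 1 / sqrt 3"
  have sgn: "sqrt 3 * z - 1 = sqrt 3 * (z - p)" for z by (simp add: p_def field_simps)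
  have "p \<le> a \<or> b \<le> p" using no_inflection Matern32 by (auto simp: p_def not_le)
  then show ?thesis
  proof
    assume "p \<le> a"
    then show ?thesis using Matern32 \<open>0 < s\<close> by (auto simp: sgn simp del: real_sqrt_eq_iff)
  next
    assume "b \<le> p"
    then show ?thesis using Matern32 \<open>0 < s\<close>
      by (auto simp: sgn mult_le_0_iff zero_le_mult_iff)
  qed
next
  case Matern52
  define p :: real where "p = (1 + sqrt 5) / (2 * sqrt 5)"
  define q :: real where "q = (sqrt 5 - 1) / (2 * sqrt 5)"
  have q: "0 < q" unfolding q_def by (simp add: real_less_rsqrt)
  \<comment> \<open>Vieta: p and - q are the roots of 5 z^2 - sqrt 5 z - 1.\<close>
  have pq: "p - q = 1 / sqrt 5" "p * q = 1 / 5"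
    by (simp_all add: p_def q_def field_simps)
  have sgn: "5 * z\<^sup>2 - sqrt 5 * z - 1 = 5 * ((z + q) * (z - p))" for z
  proof -
    have "5 * ((z + q) * (z - p)) = 5 * z\<^sup>2 - 5 * (p - q) * z - 5 * (p * q)"
      by (simp add: algebra_simps power2_eq_square)
    moreover have "5 * (p - q) = sqrt 5" "5 * (p * q) = 1" unfolding pq by (simp_all add: field_simps)
    ultimately show ?thesis by simp
  qed
  have "p \<le> a \<or> b \<le> p" using no_inflection Matern52 by (auto simp: p_def not_le)
  then show ?thesis
  proof
    assume "p \<le> a"
    then have "0 \<le> ddkappa k s z" if "z \<in> {a..b}" for z
      using that Matern52 \<open>0 < s\<close> \<open>0 \<le> a\<close> q by (simp add: sgn)
    then show ?thesis by blast
  next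
    assume b: "b \<le> p"
    have "ddkappa k s z \<le> 0" if "z \<in> {a..b}" for z
    proof -
      have "(z + q) * (z - p) \<le> 0"
        using that \<open>0 \<le> a\<close> q b by (simp add: mult_le_0_iff)
      then show ?thesis using Matern52 \<open>0 < s\<close> by (simp add: sgn mult_le_0_iff)
    qed
    then show ?thesis by blast
  qed
qed (use \<open>0 < s\<close> in simp_all)

lemma kappa_convex_or_concave:
  assumes "0 < s" and "0 \<le> a" and "inflection_points k \<inter> {a<..<b} = {}"
  shows "convex_on {a..b} (kappa k s) \<or> concave_on {a..b} (kappa k s)"
  using ddkappa_sign[OF assms] f''_ge0_imp_convex[OF _ DERIV_kappa DERIV_dkappa]
    f''_le0_imp_concave[OF _ DERIV_kappa DERIV_dkappa]
  by (metis convex_real_interval(5))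

lemma kappa_lipschitz:
  assumes "\<And>z. z \<in> {lo..hi} \<Longrightarrow> \<bar>dkappa k s z\<bar> \<le> L" and "x \<in> {lo..hi}" "y \<in> {lo..hi}"
  shows "\<bar>kappa k s x - kappa k s y\<bar> \<le> L * \<bar>x - y\<bar>"
  using field_differentiable_bound[of "{lo..hi}" "kappa k s" "dkappa k s" L x y] assms
    DERIV_kappa has_field_derivative_at_within by fastforce

section \<open>Tangents, secants and the envelopes built from them\<close>

text \<open>By convexity the difference quotient along the segment from x to z is at most f z - f x
  for every step t in (0, 1); let t tend to 0 from the right. All steps lead towards z, so x may be
  an end point of A.\<close>

lemma convex_on_above_tangent:
  fixes f :: "real \<Rightarrow> real"
  assumes cvx: "convex_on A f" and "x \<in> A" "z \<in> A" and der: "(f has_real_derivative D) (at x)"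
  shows "f x + D * (z - x) \<le> f z"
proof -
  define g where "g = (\<lambda>t. f (x + t * (z - x)))"
  have "(g has_real_derivative D * (z - x)) (at 0)"
    unfolding g_def using der by (auto intro!: derivative_eq_intros DERIV_chain2[where f = f])
  then have "((\<lambda>t. (g t - g 0) / t) \<longlongrightarrow> D * (z - x)) (at_right 0)"
    by (auto simp: DERIV_def intro: tendsto_within_subset)
  moreover have "\<forall>\<^sub>F t in at_right (0::real). (g t - g 0) / t \<le> f z - f x"
  proof -
    have "(g t - g 0) / t \<le> f z - f x" if "0 < t" "t < 1" for t
    proof -
      have "f ((1 - t) *\<^sub>R x + t *\<^sub>R z) \<le> (1 - t) * f x + t * f z"
        using convex_onD[OF cvx] that assms by simp
      moreover have "(1 - t) *\<^sub>R x + t *\<^sub>R z = x + t * (z - x)" by (simp add: algebra_simps)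
      ultimately show ?thesis using that by (simp add: g_def field_simps)
    qed
    then show ?thesis
      by (auto intro!: eventually_at_rightI[of 0 1])
  qed
  ultimately have "D * (z - x) \<le> f z - f x"
    by (intro tendsto_upperbound) auto
  then show ?thesis by simp
qed

lemma concave_on_below_tangent:
  fixes f :: "real \<Rightarrow> real"
  assumes "concave_on A f" and "x \<in> A" "z \<in> A" and "(f has_real_derivative D) (at x)"
  shows "f z \<le> f x + D * (z - x)"
  using convex_on_above_tangent[of A "\<lambda>x. - f x" x z "- D"] assms DERIV_minus[of f D]
  by (simp add: concave_on_def)

lemma convex_on_below_secant:
  assumes "convex_on {a..b} f" and "z \<in> {a..b}"
  shows "f z \<le> secant f a b z"
  using convex_onD_Icc'[OF assms] by (simp add: secant_def)

lemma concave_on_above_secant: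
  assumes "concave_on {a..b} f" and "z \<in> {a..b}"
  shows "secant f a b z \<le> f z"
  using convex_onD_Icc'[of a b "\<lambda>x. - f x" z] assms
  by (simp add: secant_def concave_on_def diff_divide_distrib algebra_simps)

lemma envelopes_valid:
  assumes "convex_on {a..b} f \<or> concave_on {a..b} f" and z: "z \<in> {a..b}"
    and der: "\<And>x. (f has_real_derivative deriv f x) (at x)"
  shows "lower_env f a b z \<le> f z" "f z \<le> upper_env f a b z"
proof -
  have ab: "a \<in> {a..b}" "b \<in> {a..b}" using z by auto
  have "lower_env f a b z \<le> f z \<and> f z \<le> upper_env f a b z"
  proof (cases "convex_on {a..b} f")
    case True
    then show ?thesis
      using convex_on_above_tangent[OF True ab(1) z der] convex_on_above_tangent[OF True ab(2) z der]
        convex_on_below_secant[OF True z]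
      by (simp add: lower_env_def upper_env_def tangent_env_def)
  next
    case False
    then have conc: "concave_on {a..b} f" using assms(1) by blast
    \<comment> \<open>Each tangent lies above a concave f, so the bound for one of them already
      carries over to their maximum.\<close>
    show ?thesis
      using False concave_on_below_tangent[OF conc ab(1) z der]
        concave_on_above_secant[OF conc z]
      by (simp add: lower_env_def upper_env_def tangent_env_def)
  qed
  then show "lower_env f a b z \<le> f z" "f z \<le> upper_env f a b z" by auto
qed

text \<open>A line through (a, f a) with slope m changes by at most L * (hi - lo) up to z, and f a
  differs from f w by at most as much again. This treats tangents, secants and, with m = 0,
  constants alike.\<close>

lemma tangent_close:
  fixes f :: "real \<Rightarrow> real"
  assumes lip: "\<And>x y. x \<in> {lo..hi} \<Longrightarrow> y \<in> {lo..hi} \<Longrightarrow> \<bar>f x - f y\<bar> \<le> L * \<bar>x - y\<bar>"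
    and "0 \<le> L" and "\<bar>m\<bar> \<le> L" and "a \<in> {lo..hi}" "z \<in> {lo..hi}" "w \<in> {lo..hi}"
  shows "\<bar>f a + m * (z - a) - f w\<bar> \<le> 2 * L * (hi - lo)"
proof -
  have "\<bar>f a - f w\<bar> \<le> L * (hi - lo)"
    using lip[of a w] mult_left_mono[of "\<bar>a - w\<bar>" "hi - lo" L] assms by fastforce
  moreover have "\<bar>m * (z - a)\<bar> \<le> L * (hi - lo)"
    unfolding abs_mult using assms by (intro mult_mono) auto
  ultimately show ?thesis by linarith
qed

text \<open>Every candidate line passes through a point of the graph with slope bounded by L, so
  \<open>tangent_close\<close> applies whichever one the envelope selects. The points z and w are
  independent, so that an estimator value at one point can be compared with the mean at
  another.\<close>

lemma envelopes_close:
  fixes f :: "real \<Rightarrow> real"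
  assumes lip: "\<And>x y. x \<in> {lo..hi} \<Longrightarrow> y \<in> {lo..hi} \<Longrightarrow> \<bar>f x - f y\<bar> \<le> L * \<bar>x - y\<bar>"
    and der: "\<And>x. x \<in> {lo..hi} \<Longrightarrow> \<bar>deriv f x\<bar> \<le> L"
    and "lo \<le> a" "a < b" "b \<le> hi" "z \<in> {lo..hi}" "w \<in> {lo..hi}"
  shows "\<bar>lower_env f a b z - f w\<bar> \<le> 2 * L * (hi - lo)"
    "\<bar>upper_env f a b z - f w\<bar> \<le> 2 * L * (hi - lo)"
proof -
  have ab: "a \<in> {lo..hi}" "b \<in> {lo..hi}" using assms by auto
  have "0 \<le> L" using der[OF ab(1)] by linarith
  have "\<bar>(f b - f a) / (b - a)\<bar> \<le> L"
    using lip[OF ab(2) ab(1)] \<open>a < b\<close> by (simp add: divide_le_eq)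
  then have "\<bar>secant f a b z - f w\<bar> \<le> 2 * L * (hi - lo)"
    unfolding secant_def using tangent_close[OF lip \<open>0 \<le> L\<close>] ab assms by blast
  moreover have "\<bar>tangent_env f a b z - f w\<bar> \<le> 2 * L * (hi - lo)"
    unfolding tangent_env_def max_def
    using tangent_close[OF lip \<open>0 \<le> L\<close> der] ab assms by presburger
  ultimately show "\<bar>lower_env f a b z - f w\<bar> \<le> 2 * L * (hi - lo)"
    "\<bar>upper_env f a b z - f w\<bar> \<le> 2 * L * (hi - lo)"
    by (simp_all add: lower_env_def upper_env_def)
qed

lemma kprof_convex_or_concave:
  assumes "valid_gp G" and "0 \<le> a" and "inflection_points (kern G) \<inter> {a<..<b} = {}"
  shows "convex_on {a..b} (kprof G) \<or> concave_on {a..b} (kprof G)"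
  using kappa_convex_or_concave[of "sigf2 G"] assms by (simp add: valid_gp_def kprof_def)

lemma DERIV_kprof: "(kprof G has_real_derivative deriv (kprof G) z) (at z)"
  unfolding kprof_def deriv_kappa by (rule DERIV_kappa)

section \<open>Geometry of the analytical bounds\<close>

lemma zeta_arg_nonneg: "0 \<le> r \<Longrightarrow> 0 \<le> zeta_arg k r"
  by (cases k) auto

lemma zeta_arg_mono: "0 \<le> r \<Longrightarrow> r \<le> r' \<Longrightarrow> zeta_arg k r \<le> zeta_arg k r'"
  by (cases k) (auto intro: power_mono)

lemma zeta_arg_strict_mono: "0 \<le> r \<Longrightarrow> r < r' \<Longrightarrow> zeta_arg k r < zeta_arg k r'"
  by (cases k) (auto intro: power_strict_mono)

lemma continuous_on_zeta_arg [continuous_intros]: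
  "continuous_on A f \<Longrightarrow> continuous_on A (\<lambda>x. zeta_arg k (f x))"
  by (cases k) (auto intro: continuous_intros)

lemma scaled_dist_alt:
  "scaled_dist G x y = sqrt (\<Sum>j\<in>UNIV. \<bar>x $ j - y $ j\<bar>\<^sup>2 / (scales G $ j)\<^sup>2)"
  by (simp add: scaled_dist_def norm_vec_def L2_set_def power_divide)

lemma continuous_on_zeta:
  assumes "valid_gp G"
  shows "continuous_on A (zeta G i)"
proof -
  have "scales G $ j \<noteq> 0" for j using assms by (auto simp: valid_gp_def less_le)
  then show ?thesis
    unfolding zeta_def scaled_dist_alt by (intro continuous_intros) auto
qed

lemma zeta_nonneg: "0 \<le> zeta G i x"
  by (simp add: zeta_def scaled_dist_def zeta_arg_nonneg)

lemma mem_pts: "x \<in> pts B \<longleftrightarrow> (\<forall>j. fst B $ j \<le> x $ j \<and> x $ j \<le> snd B $ j)"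
  by (auto simp: pts_def mem_box_cart)

lemma near_dist_le: "x \<in> pts B \<Longrightarrow> near_dist G B i j \<le> \<bar>x $ j - inputs G i $ j\<bar>"
  unfolding near_dist_def
  using infdist_le[of "x $ j" "{fst B $ j..snd B $ j}" "inputs G i $ j"]
  by (auto simp: mem_pts dist_real_def abs_minus_commute)

lemma near_dist_nonneg: "0 \<le> near_dist G B i j"
  by (simp add: near_dist_def infdist_nonneg)

lemma le_far_dist: "x \<in> pts B \<Longrightarrow> \<bar>x $ j - inputs G i $ j\<bar> \<le> far_dist G B i j"
  unfolding far_dist_def mem_pts by (drule spec[of _ j]) arith

lemma zeta_in_range:
  assumes "x \<in> pts B"
  shows "zeta_lo G B i \<le> zeta G i x" "zeta G i x \<le> zeta_hi G B i"
proof -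
  have *: "(near_dist G B i j)\<^sup>2 \<le> \<bar>x $ j - inputs G i $ j\<bar>\<^sup>2"
    "\<bar>x $ j - inputs G i $ j\<bar>\<^sup>2 \<le> (far_dist G B i j)\<^sup>2" for j
    by (intro power_mono near_dist_le[OF assms] near_dist_nonneg le_far_dist[OF assms] abs_ge_zero)+
  show "zeta_lo G B i \<le> zeta G i x" "zeta G i x \<le> zeta_hi G B i"
    unfolding zeta_lo_def zeta_hi_def zeta_def scaled_dist_alt
    by (intro zeta_arg_mono real_sqrt_le_mono real_sqrt_ge_zero sum_mono sum_nonneg divide_right_mono *;
        simp)+
qed

lemma node_less: "is_node G B \<Longrightarrow> fst B $ j < snd B $ j"
  by (simp add: is_node_def)

text \<open>A box is a product, so nearest points chosen separately in each coordinate combine to a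
  point of the box.\<close>

lemma zeta_lo_attained:
  assumes "is_node G B"
  obtains x where "x \<in> pts B" "zeta G i x = zeta_lo G B i"
proof -
  have "\<exists>q. q \<in> {fst B $ j..snd B $ j} \<and> near_dist G B i j = \<bar>q - inputs G i $ j\<bar>" for j
    using infdist_attains_inf[of "{fst B $ j..snd B $ j}" "inputs G i $ j"] node_less[OF assms, of j]
    by (auto simp: near_dist_def dist_real_def abs_minus_commute)
  then have "\<forall>j. \<exists>q. q \<in> {fst B $ j..snd B $ j} \<and> near_dist G B i j = \<bar>q - inputs G i $ j\<bar>" by blast
  from choice[OF this] obtain q where q: "\<And>j. q j \<in> {fst B $ j..snd B $ j}"
    "\<And>j. near_dist G B i j = \<bar>q j - inputs G i $ j\<bar>" by blast
  show thesis
  proof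
    show "(\<chi> j. q j) \<in> pts B" using q(1) by (simp add: mem_pts)
    show "zeta G i (\<chi> j. q j) = zeta_lo G B i"
      by (simp add: zeta_def scaled_dist_alt zeta_lo_def q(2))
  qed
qed

lemma zeta_hi_attained:
  assumes "is_node G B"
  obtains x where "x \<in> pts B" "zeta G i x = zeta_hi G B i"
proof -
  \<comment> \<open>The vertex that takes, in each coordinate, the end point farther from the
    input.\<close>
  define q where "q j = (if \<bar>fst B $ j - inputs G i $ j\<bar> \<le> \<bar>snd B $ j - inputs G i $ j\<bar>
    then snd B $ j else fst B $ j)" for j
  have q: "far_dist G B i j = \<bar>q j - inputs G i $ j\<bar>" for j
    by (simp add: q_def far_dist_def)
  show thesis
  proof
    show "(\<chi> j. q j) \<in> pts B"
      using node_less[OF assms] by (auto simp: mem_pts q_def less_imp_le)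
    show "zeta G i (\<chi> j. q j) = zeta_hi G B i"
      by (simp add: zeta_def scaled_dist_alt zeta_hi_def q)
  qed
qed

text \<open>The midpoint of a nondegenerate side is strictly closer to any given number than the
  farther end point. This keeps the range of \<open>zeta\<close> on a node nondegenerate, so that
  strictly increasing breakpoints exist.\<close>

lemma near_dist_less_far_dist:
  assumes "is_node G B"
  shows "near_dist G B i j < far_dist G B i j"
proof -
  define m where "m = (fst B $ j + snd B $ j) / 2"
  have "near_dist G B i j \<le> dist (inputs G i $ j) m"
    unfolding near_dist_def using node_less[OF assms, of j] by (intro infdist_le) (simp add: m_def)
  also have "\<dots> < far_dist G B i j"
    using node_less[OF assms, of j] unfolding far_dist_def m_def dist_real_def max_def abs_if
    by (simp add: field_simps)
  finally show ?thesis .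
qed

lemma zeta_lo_less_zeta_hi:
  assumes "valid_gp G" "is_node G B"
  shows "zeta_lo G B i < zeta_hi G B i"
  unfolding zeta_lo_def zeta_hi_def
proof (intro zeta_arg_strict_mono real_sqrt_less_mono sum_strict_mono)
  fix j :: 'b
  have "0 < (scales G $ j)\<^sup>2" using assms(1) unfolding valid_gp_def by (metis zero_less_power)
  moreover have "(near_dist G B i j)\<^sup>2 < (far_dist G B i j)\<^sup>2"
    by (intro power_strict_mono near_dist_less_far_dist[OF assms(2)] near_dist_nonneg) simp
  ultimately show "(near_dist G B i j)\<^sup>2 / (scales G $ j)\<^sup>2 < (far_dist G B i j)\<^sup>2 / (scales G $ j)\<^sup>2"
    by (rule divide_strict_right_mono[rotated])
qed (auto intro!: sum_nonneg)

lemma zeta_width_tendsto_0: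
  assumes G: "valid_gp G" and nodes: "\<And>k. is_node G (b k)"
    and diam: "(\<lambda>k. diameter (pts (b k))) \<longlonglongrightarrow> 0"
  shows "(\<lambda>k. zeta_hi G (b k) i - zeta_lo G (b k) i) \<longlonglongrightarrow> 0"
proof -
  have "\<forall>k. \<exists>x. x \<in> pts (b k) \<and> zeta G i x = zeta_lo G (b k) i"
    using zeta_lo_attained[OF nodes] by metis
  then obtain x where x: "\<And>k. x k \<in> pts (b k)" "\<And>k. zeta G i (x k) = zeta_lo G (b k) i"
    by metis
  have "\<forall>k. \<exists>y. y \<in> pts (b k) \<and> zeta G i y = zeta_hi G (b k) i"
    using zeta_hi_attained[OF nodes] by metis
  then obtain y where y: "\<And>k. y k \<in> pts (b k)" "\<And>k. zeta G i (y k) = zeta_hi G (b k) i"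
    by metis
  \<comment> \<open>The points attaining the two ends of the range lie in the same box, hence at
    most a diameter apart; uniform continuity carries this over to their \<open>zeta\<close>
    values.\<close>
  have "dist (y k) (x k) \<le> diameter (pts (b k))" for k
    using x y by (intro diameter_bounded_bound) (simp_all add: pts_def bounded_cbox)
  then have "(\<lambda>k. dist (y k) (x k)) \<longlonglongrightarrow> 0"
    by (intro tendsto_sandwich[OF _ _ tendsto_const diam]) auto
  moreover have "x k \<in> domain G" "y k \<in> domain G" for k
    using x(1)[of k] y(1)[of k] nodes[of k] by (auto simp: is_node_def)
  moreover have "uniformly_continuous_on (domain G) (zeta G i)"
    using continuous_on_zeta[OF G] unfolding domain_def
    by (intro compact_uniformly_continuous compact_cbox)
  ultimately have "(\<lambda>k. dist (zeta G i (y k)) (zeta G i (x k))) \<longlonglongrightarrow> 0"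
    unfolding uniformly_continuous_on_sequentially by blast
  then show ?thesis
    using x y by (simp add: dist_real_def tendsto_rabs_zero_iff)
qed

section \<open>Piecewise-linear envelopes and the PALM estimator\<close>

text \<open>Take the largest index s, other than the last, with \<open>\<eta> ! s\<close> \<le> z.
  By maximality, or by z \<le> \<open>last \<eta>\<close> if s is the last but one, the next
  breakpoint is at least z. The lemma also locates a coordinate among the cuts of a box.\<close>

lemma segments_at_nonempty:
  assumes "2 \<le> length \<eta>" "hd \<eta> \<le> z" "z \<le> last \<eta>"
  shows "segments_at \<eta> z \<noteq> {}"
proof -
  define A where "A = {s. Suc s < length \<eta> \<and> \<eta> ! s \<le> z}"
  have "finite A" unfolding A_def by (rule finite_subset[of _ "{..length \<eta>}"]) auto
  moreover have "0 \<in> A" using assms by (cases \<eta>) (auto simp: A_def)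
  ultimately have m: "Max A \<in> A" "\<And>s. s \<in> A \<Longrightarrow> s \<le> Max A" by (auto intro: Max_in)
  have "z \<le> \<eta> ! Suc (Max A)"
  proof (cases "Suc (Suc (Max A)) < length \<eta>")
    case True
    then show ?thesis using m(2)[of "Suc (Max A)"] by (fastforce simp: A_def)
  next
    case False
    then have "Suc (Max A) = length \<eta> - 1" using m(1) by (auto simp: A_def)
    moreover have "\<eta> \<noteq> []" using assms(1) by auto
    ultimately show ?thesis using assms(3) by (simp add: last_conv_nth)
  qed
  then show ?thesis using m(1) by (auto simp: A_def segments_at_def)
qed

lemma segment_in_range:
  assumes bp: "valid_breakpoints G B i \<eta>" and s: "Suc s < length \<eta>"
  shows "\<eta> ! s < \<eta> ! Suc s" "zeta_lo G B i \<le> \<eta> ! s" "\<eta> ! Suc s \<le> zeta_hi G B i"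
    "inflection_points (kern G) \<inter> {\<eta> ! s<..<\<eta> ! Suc s} = {}"
proof -
  have sorted: "\<And>u v. u < v \<Longrightarrow> v < length \<eta> \<Longrightarrow> \<eta> ! u < \<eta> ! v"
    using bp by (auto simp: valid_breakpoints_def sorted_wrt_iff_nth_less)
  have "\<eta> \<noteq> []" using s by auto
  have lo: "\<eta> ! 0 = zeta_lo G B i" and hi: "\<eta> ! (length \<eta> - 1) = zeta_hi G B i"
    using bp \<open>\<eta> \<noteq> []\<close> by (auto simp: valid_breakpoints_def hd_conv_nth last_conv_nth)
  show "\<eta> ! s < \<eta> ! Suc s" using sorted s by blast
  show slo: "zeta_lo G B i \<le> \<eta> ! s"
    using sorted[of 0 s] s lo by (cases "s = 0") auto
  show shi: "\<eta> ! Suc s \<le> zeta_hi G B i"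
    using sorted[of "Suc s" "length \<eta> - 1"] s hi by (cases "Suc s = length \<eta> - 1") (auto intro: less_imp_le)
  show "inflection_points (kern G) \<inter> {\<eta> ! s<..<\<eta> ! Suc s} = {}"
  proof (rule ccontr)
    assume "inflection_points (kern G) \<inter> {\<eta> ! s<..<\<eta> ! Suc s} \<noteq> {}"
    then obtain p where p: "p \<in> inflection_points (kern G)" "\<eta> ! s < p" "p < \<eta> ! Suc s" by auto
    with slo shi have "p \<in> set \<eta>" using bp by (auto simp: valid_breakpoints_def)
    then obtain t where t: "t < length \<eta>" "p = \<eta> ! t" by (auto simp: in_set_conv_nth)
    \<comment> \<open>Sortedness would place the index t strictly between s and Suc s.\<close>
    then have "\<not> t < s" "t \<noteq> s" "t \<noteq> Suc s" "\<not> Suc s < t"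
      using p sorted[of t s] sorted[of "Suc s" t] s by auto
    then show False by linarith
  qed
qed

lemma zeta_lo_nonneg: "0 \<le> zeta_lo G B i"
  by (auto simp: zeta_lo_def intro!: zeta_arg_nonneg sum_nonneg)

text \<open>Reduces Min and Max to single segments, possibly two different ones. The set of segments
  is nonempty because \<open>zeta\<close> stays within the range of the breakpoints.\<close>

lemma kpl_attained:
  assumes bp: "valid_breakpoints G B i \<eta>" and x: "x \<in> pts B"
  obtains s t where "s \<in> segments_at \<eta> (zeta G i x)" "t \<in> segments_at \<eta> (zeta G i x)"
    "kpl_lo G \<eta> i x = lower_env (kprof G) (\<eta> ! s) (\<eta> ! Suc s) (zeta G i x)"
    "kpl_hi G \<eta> i x = upper_env (kprof G) (\<eta> ! t) (\<eta> ! Suc t) (zeta G i x)"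
proof -
  have "finite (segments_at \<eta> (zeta G i x))"
    unfolding segments_at_def by (rule finite_subset[of _ "{..length \<eta>}"]) auto
  moreover have "segments_at \<eta> (zeta G i x) \<noteq> {}"
    using bp zeta_in_range[OF x, of G i] by (intro segments_at_nonempty) (auto simp: valid_breakpoints_def)
  ultimately have
    "kpl_lo G \<eta> i x \<in> (\<lambda>s. lower_env (kprof G) (\<eta> ! s) (\<eta> ! Suc s) (zeta G i x))
      ` segments_at \<eta> (zeta G i x)"
    "kpl_hi G \<eta> i x \<in> (\<lambda>s. upper_env (kprof G) (\<eta> ! s) (\<eta> ! Suc s) (zeta G i x))
      ` segments_at \<eta> (zeta G i x)"
    unfolding kpl_lo_def kpl_hi_def by (intro Min_in Max_in finite_imageI; simp)+
  then show thesis using that by blast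
qed

lemma kpl_valid:
  assumes G: "valid_gp G" and bp: "valid_breakpoints G B i \<eta>" and x: "x \<in> pts B"
  shows "kpl_lo G \<eta> i x \<le> kval G i x" "kval G i x \<le> kpl_hi G \<eta> i x"
proof -
  obtain s t where st: "s \<in> segments_at \<eta> (zeta G i x)" "t \<in> segments_at \<eta> (zeta G i x)"
    "kpl_lo G \<eta> i x = lower_env (kprof G) (\<eta> ! s) (\<eta> ! Suc s) (zeta G i x)"
    "kpl_hi G \<eta> i x = upper_env (kprof G) (\<eta> ! t) (\<eta> ! Suc t) (zeta G i x)"
    using kpl_attained[OF bp x] .
  have *: "lower_env (kprof G) (\<eta> ! s) (\<eta> ! Suc s) (zeta G i x) \<le> kprof G (zeta G i x)"
    "kprof G (zeta G i x) \<le> upper_env (kprof G) (\<eta> ! s) (\<eta> ! Suc s) (zeta G i x)"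
    if "s \<in> segments_at \<eta> (zeta G i x)" for s
  proof -
    have s: "Suc s < length \<eta>" "zeta G i x \<in> {\<eta> ! s..\<eta> ! Suc s}"
      using that by (auto simp: segments_at_def)
    have "0 \<le> \<eta> ! s" using segment_in_range(2)[OF bp s(1)] zeta_lo_nonneg order_trans by blast
    then have "convex_on {\<eta> ! s..\<eta> ! Suc s} (kprof G) \<or> concave_on {\<eta> ! s..\<eta> ! Suc s} (kprof G)"
      using kprof_convex_or_concave[OF G] segment_in_range(4)[OF bp s(1)] by blast
    then show "lower_env (kprof G) (\<eta> ! s) (\<eta> ! Suc s) (zeta G i x) \<le> kprof G (zeta G i x)"
      "kprof G (zeta G i x) \<le> upper_env (kprof G) (\<eta> ! s) (\<eta> ! Suc s) (zeta G i x)"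
      using envelopes_valid[OF _ s(2) DERIV_kprof] by blast+
  qed
  show "kpl_lo G \<eta> i x \<le> kval G i x" "kval G i x \<le> kpl_hi G \<eta> i x"
    using * st by (simp_all add: kval_def)
qed

lemma kprof_lipschitz:
  assumes "\<And>z. z \<in> {lo..hi} \<Longrightarrow> \<bar>deriv (kprof G) z\<bar> \<le> L" and "x \<in> {lo..hi}" "y \<in> {lo..hi}"
  shows "\<bar>kprof G x - kprof G y\<bar> \<le> L * \<bar>x - y\<bar>"
  using kappa_lipschitz[of lo hi "kern G" "sigf2 G" L x y] assms by (simp add: kprof_def deriv_kappa)

lemma kpl_close:
  assumes bp: "valid_breakpoints G B i \<eta>" and x: "x \<in> pts B" and y: "y \<in> pts B"
    and L: "\<And>z. z \<in> {zeta_lo G B i..zeta_hi G B i} \<Longrightarrow> \<bar>deriv (kprof G) z\<bar> \<le> L"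
  shows "\<bar>kpl_lo G \<eta> i y - kval G i x\<bar> \<le> 2 * L * (zeta_hi G B i - zeta_lo G B i)"
    "\<bar>kpl_hi G \<eta> i y - kval G i x\<bar> \<le> 2 * L * (zeta_hi G B i - zeta_lo G B i)"
proof -
  obtain s t where st: "s \<in> segments_at \<eta> (zeta G i y)" "t \<in> segments_at \<eta> (zeta G i y)"
    "kpl_lo G \<eta> i y = lower_env (kprof G) (\<eta> ! s) (\<eta> ! Suc s) (zeta G i y)"
    "kpl_hi G \<eta> i y = upper_env (kprof G) (\<eta> ! t) (\<eta> ! Suc t) (zeta G i y)"
    using kpl_attained[OF bp y] .
  have "Suc s < length \<eta>" "Suc t < length \<eta>" using st by (auto simp: segments_at_def)
  moreover have "zeta G i x \<in> {zeta_lo G B i..zeta_hi G B i}" "zeta G i y \<in> {zeta_lo G B i..zeta_hi G B i}"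
    using zeta_in_range[OF x] zeta_in_range[OF y] by auto
  ultimately show "\<bar>kpl_lo G \<eta> i y - kval G i x\<bar> \<le> 2 * L * (zeta_hi G B i - zeta_lo G B i)"
    "\<bar>kpl_hi G \<eta> i y - kval G i x\<bar> \<le> 2 * L * (zeta_hi G B i - zeta_lo G B i)"
    unfolding st kval_def
    using segment_in_range[OF bp]
    by (intro envelopes_close[OF kprof_lipschitz[OF L] L]; blast)+
qed

lemma kprof_range_close:
  assumes x: "x \<in> pts B"
    and L: "\<And>z. z \<in> {zeta_lo G B i..zeta_hi G B i} \<Longrightarrow> \<bar>deriv (kprof G) z\<bar> \<le> L"
  shows "\<bar>kprof G (zeta_hi G B i) - kval G i x\<bar> \<le> 2 * L * (zeta_hi G B i - zeta_lo G B i)"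
    "\<bar>kprof G (zeta_lo G B i) - kval G i x\<bar> \<le> 2 * L * (zeta_hi G B i - zeta_lo G B i)"
proof -
  note range = zeta_in_range[OF x, of G i]
  have "0 \<le> L" using L[of "zeta G i x"] range by auto
  \<comment> \<open>The end-point values are lines of slope 0 through points of the graph.\<close>
  then show "\<bar>kprof G (zeta_hi G B i) - kval G i x\<bar> \<le> 2 * L * (zeta_hi G B i - zeta_lo G B i)"
    "\<bar>kprof G (zeta_lo G B i) - kval G i x\<bar> \<le> 2 * L * (zeta_hi G B i - zeta_lo G B i)"
    using tangent_close[OF kprof_lipschitz[OF L] \<open>0 \<le> L\<close>, where m = 0] range
    unfolding kval_def by auto
qed

lemma kprof_antimono:
  assumes "valid_gp G" "0 \<le> a" "a \<le> b"
  shows "kprof G b \<le> kprof G a"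
proof -
  have "dkappa k s z \<le> 0" if "0 \<le> z" "0 < s" for k s z
    using that by (cases k) (auto simp: mult_le_0_iff zero_le_mult_iff)
  then show ?thesis
    unfolding kprof_def using assms DERIV_kappa
    by (intro DERIV_nonpos_imp_nonincreasing[of a b]) (auto simp: valid_gp_def, meson order_trans)
qed

section \<open>From kernel bounds to the estimator and its minimum\<close>

lemma alpha_split:
  "alpha G $ i = alpha_pos G i - alpha_neg G i"
  "\<bar>alpha G $ i\<bar> = alpha_pos G i + alpha_neg G i"
  "0 \<le> alpha_pos G i" "0 \<le> alpha_neg G i"
  by (auto simp: alpha_pos_def alpha_neg_def)

lemma weighted_term_le:
  assumes "l \<le> k" "k \<le> u"
  shows "alpha_pos G i * l - alpha_neg G i * u \<le> alpha G $ i * k"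
  using mult_left_mono[OF assms(1) alpha_split(3)[of G i]]
    mult_left_mono[OF assms(2) alpha_split(4)[of G i]]
  by (simp add: alpha_split(1) left_diff_distrib)

text \<open>An error w in each kernel bound costs w times \<open>alpha_pos\<close> in one part and w
  times \<open>alpha_neg\<close> in the other; the two weights add up to the absolute value of
  alpha.\<close>

lemma weighted_term_close:
  assumes "\<bar>l - k\<bar> \<le> w" "\<bar>u - k\<bar> \<le> w"
  shows "alpha G $ i * k - \<bar>alpha G $ i\<bar> * w \<le> alpha_pos G i * l - alpha_neg G i * u"
proof -
  have "k - w \<le> l" "u \<le> k + w" using assms by auto
  then have "alpha_pos G i * (k - w) \<le> alpha_pos G i * l" "alpha_neg G i * u \<le> alpha_neg G i * (k + w)"
    by (auto intro: mult_left_mono alpha_split)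
  then show ?thesis by (simp add: alpha_split(2)) (simp add: alpha_split(1) algebra_simps)
qed

definition node_breakpoints ::
  "('n::finite, 'd::finite) gp \<Rightarrow> real \<Rightarrow> 'd box \<Rightarrow> ('n \<Rightarrow> real list) \<Rightarrow> bool" where
  "node_breakpoints G \<rho> B \<eta> \<longleftrightarrow> (\<forall>i\<in>important G \<rho> B. valid_breakpoints G B i (\<eta> i))"

lemma sum_important:
  "(\<Sum>i\<in>UNIV. f i) = (\<Sum>i\<in>important G \<rho> B. f i) + (\<Sum>i\<in>UNIV - important G \<rho> B. f i)"
  by (simp add: sum.subset_diff[of "important G \<rho> B" UNIV] add.commute)

lemma palm_mean_le_post_mean:
  assumes G: "valid_gp G" and bps: "node_breakpoints G \<rho> B \<eta>" and x: "x \<in> pts B"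
  shows "palm_mean G \<rho> B \<eta> x \<le> post_mean G x"
  unfolding palm_mean_def post_mean_def sum_important[of _ G \<rho> B]
proof (intro add_mono sum_mono)
  fix i assume "i \<in> important G \<rho> B"
  then show "alpha_pos G i * kpl_lo G (\<eta> i) i x - alpha_neg G i * kpl_hi G (\<eta> i) i x
      \<le> alpha G $ i * kval G i x"
    using kpl_valid[OF G _ x] bps by (intro weighted_term_le) (auto simp: node_breakpoints_def)
next
  fix i
  show "term_lo G B i \<le> alpha G $ i * kval G i x"
    unfolding term_lo_def kval_def using zeta_in_range[OF x, of G i]
    by (intro weighted_term_le kprof_antimono[OF G] zeta_nonneg zeta_lo_nonneg)
qed

text \<open>With x fixed and y free this bounds the estimator below on the whole box at once, so it
  both makes the infimum in \<open>palm_LB\<close> meaningful and compares it with the mean at x.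
  Important and unimportant terms obey the same error bound, whatever the threshold.\<close>

lemma post_mean_le_palm_mean:
  assumes bps: "node_breakpoints G \<rho> B \<eta>" and x: "x \<in> pts B" and y: "y \<in> pts B"
    and L: "\<And>i z. z \<in> {zeta_lo G B i..zeta_hi G B i} \<Longrightarrow> \<bar>deriv (kprof G) z\<bar> \<le> L"
  shows "post_mean G x - (\<Sum>i\<in>UNIV. \<bar>alpha G $ i\<bar> * (2 * L * (zeta_hi G B i - zeta_lo G B i)))
    \<le> palm_mean G \<rho> B \<eta> y"
  unfolding palm_mean_def post_mean_def sum_subtractf[symmetric]
  unfolding sum_important[of _ G \<rho> B]
proof (intro add_mono sum_mono)
  fix i assume "i \<in> important G \<rho> B"
  then have "valid_breakpoints G B i (\<eta> i)" using bps by (simp add: node_breakpoints_def)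
  then show "alpha G $ i * kval G i x - \<bar>alpha G $ i\<bar> * (2 * L * (zeta_hi G B i - zeta_lo G B i))
    \<le> alpha_pos G i * kpl_lo G (\<eta> i) i y - alpha_neg G i * kpl_hi G (\<eta> i) i y"
    by (intro weighted_term_close kpl_close x y L)
next
  fix i
  show "alpha G $ i * kval G i x - \<bar>alpha G $ i\<bar> * (2 * L * (zeta_hi G B i - zeta_lo G B i))
    \<le> term_lo G B i"
    unfolding term_lo_def by (intro weighted_term_close kprof_range_close x L)
qed

text \<open>A single L serves all nodes: \<open>zeta\<close> is bounded by some Z on the compact
  domain, each \<open>zeta_hi\<close> is attained inside the domain, and the derivative is
  continuous on [0, Z].\<close>

lemma deriv_kprof_bound:
  assumes G: "valid_gp G"
  obtains L where "\<And>B i z. is_node G B \<Longrightarrow> z \<in> {zeta_lo G B i..zeta_hi G B i} \<Longrightarrow> \<bar>deriv (kprof G) z\<bar> \<le> L"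
proof -
  have "compact (\<Union>i. zeta G i ` domain G)"
    using continuous_on_zeta[OF G] unfolding domain_def
    by (intro compact_UN compact_continuous_image compact_cbox) auto
  then have "bdd_above (\<Union>i. zeta G i ` domain G)"
    by (intro bounded_imp_bdd_above compact_imp_bounded)
  then obtain Z where Z_bound: "\<forall>z\<in>(\<Union>i. zeta G i ` domain G). z \<le> Z"
    unfolding bdd_above_def ..
  have Z: "zeta G i x \<le> Z" if "x \<in> domain G" for i x
    by (rule bspec[OF Z_bound]) (use that in auto)
  have "compact (deriv (kprof G) ` {0..Z})"
    unfolding kprof_def deriv_kappa
    by (intro compact_continuous_image continuous_on_dkappa compact_Icc)
  then have "bounded (deriv (kprof G) ` {0..Z})" by (rule compact_imp_bounded)
  then obtain L where L: "\<forall>y\<in>deriv (kprof G) ` {0..Z}. \<bar>y\<bar> \<le> L"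
    unfolding bounded_real ..
  show thesis
  proof
    fix B i z assume B: "is_node G B" and z: "z \<in> {zeta_lo G B i..zeta_hi G B i}"
    obtain x where "x \<in> pts B" "zeta G i x = zeta_hi G B i" using zeta_hi_attained[OF B] .
    then have "zeta_hi G B i \<le> Z" using Z[of x i] B by (auto simp: is_node_def)
    then have "z \<in> {0..Z}" using z zeta_lo_nonneg[of G B i] by simp
    then show "\<bar>deriv (kprof G) z\<bar> \<le> L" using L by simp
  qed
qed

lemma pts_nonempty: "is_node G B \<Longrightarrow> pts B \<noteq> {}"
  using node_less[of G B] mem_pts[of "fst B" B] by (auto simp: less_imp_le)

lemma palm_LB_le_post_mean:
  assumes G: "valid_gp G" and B: "is_node G B" and bps: "node_breakpoints G \<rho> B \<eta>" and x: "x \<in> pts B"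
  shows "palm_LB G \<rho> B \<eta> \<le> post_mean G x"
proof -
  obtain L where L: "\<And>i z. z \<in> {zeta_lo G B i..zeta_hi G B i} \<Longrightarrow> \<bar>deriv (kprof G) z\<bar> \<le> L"
    using deriv_kprof_bound[OF G] B by metis
  \<comment> \<open>A real infimum is a lower bound only for sets bounded below.\<close>
  have "bdd_below (palm_mean G \<rho> B \<eta> ` pts B)"
    by (rule bdd_belowI2, rule post_mean_le_palm_mean[OF bps x _ L])
  then have "palm_LB G \<rho> B \<eta> \<le> palm_mean G \<rho> B \<eta> x"
    unfolding palm_LB_def using x by (intro cINF_lower)
  also have "\<dots> \<le> post_mean G x" by (rule palm_mean_le_post_mean[OF G bps x])
  finally show ?thesis .
qed

lemma palm_LB_converges:
  assumes G: "valid_gp G" and nodes: "\<And>k. is_node G (b k)"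
    and bps: "\<And>k. node_breakpoints G \<rho> (b k) (\<eta> k)" and x: "\<And>k. x k \<in> pts (b k)"
    and diam: "(\<lambda>k. diameter (pts (b k))) \<longlonglongrightarrow> 0"
  shows "(\<lambda>k. post_mean G (x k) - palm_LB G \<rho> (b k) (\<eta> k)) \<longlonglongrightarrow> 0"
proof -
  obtain L where L: "\<And>B i z. is_node G B \<Longrightarrow> z \<in> {zeta_lo G B i..zeta_hi G B i} \<Longrightarrow> \<bar>deriv (kprof G) z\<bar> \<le> L"
    using deriv_kprof_bound[OF G] by blast
  define e where "e k = (\<Sum>i\<in>UNIV. \<bar>alpha G $ i\<bar> * (2 * L * (zeta_hi G (b k) i - zeta_lo G (b k) i)))" for k
  have "e \<longlonglongrightarrow> (\<Sum>i\<in>UNIV. \<bar>alpha G $ i\<bar> * (2 * L * 0))"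
    unfolding e_def by (intro tendsto_intros zeta_width_tendsto_0[OF G nodes diam])
  then have e: "e \<longlonglongrightarrow> 0" by simp
  have "post_mean G (x k) - palm_LB G \<rho> (b k) (\<eta> k) \<le> e k" for k
  proof -
    have "post_mean G (x k) - e k \<le> palm_LB G \<rho> (b k) (\<eta> k)"
      unfolding palm_LB_def e_def
      by (intro cINF_greatest pts_nonempty[OF nodes] post_mean_le_palm_mean[OF bps x] L[OF nodes])
    then show ?thesis by simp
  qed
  moreover have "0 \<le> post_mean G (x k) - palm_LB G \<rho> (b k) (\<eta> k)" for k
    using palm_LB_le_post_mean[OF G nodes bps x] by simp
  ultimately show ?thesis
    by (intro tendsto_sandwich[OF _ _ tendsto_const e] always_eventually) auto
qed

text \<open>Guarantees that an unsolved node can be solved, so that a run cannot get stuck there.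
  The coarsest choice works: the two ends and the inflection points strictly between them.\<close>

lemma valid_breakpoints_exist:
  assumes "valid_gp G" "is_node G B"
  shows "\<exists>\<eta>. valid_breakpoints G B i \<eta>"
proof -
  have fin: "finite (inflection_points k)" for k by (cases k) auto
  define A where "A = inflection_points (kern G) \<inter> {zeta_lo G B i<..<zeta_hi G B i}"
  have "finite A" using fin by (simp add: A_def)
  then have "valid_breakpoints G B i (zeta_lo G B i # sorted_list_of_set A @ [zeta_hi G B i])"
    using zeta_lo_less_zeta_hi[OF assms, of i]
    by (auto simp: valid_breakpoints_def sorted_wrt_append A_def)
  then show ?thesis ..
qed

section \<open>Branch and bound\<close>

lemma box_split_cuts:
  fixes c :: "nat \<Rightarrow> real"
  assumes "\<forall>k<m. c k < c (Suc k)" and "k \<le> m"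
  shows "c 0 \<le> c k" "c k \<le> c m"
proof -
  have less: "c k < c (Suc k)" if "k < m" for k using assms(1) that by blast
  show "c 0 \<le> c k"
    using assms(2)
  proof (induction k)
    case (Suc k)
    then show ?case using less[of k] by simp
  qed simp
  show "c k \<le> c m"
    using assms(2)
  proof (induction k rule: inc_induct)
    case (step k)
    then show ?case using less[of k] by simp
  qed simp
qed

lemma box_split_pts:
  assumes "box_split B \<C>"
  shows "finite \<C>" "\<And>z. z \<in> pts B \<Longrightarrow> \<exists>C\<in>\<C>. z \<in> pts C"
    and "is_node G B \<Longrightarrow> C \<in> \<C> \<Longrightarrow> is_node G C \<and> pts C \<subseteq> pts B"
proof -
  obtain j and m :: nat and c where m: "2 \<le> m" and c: "c 0 = fst B $ j" "c m = snd B $ j"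
    "\<forall>k<m. c k < c (Suc k)"
    and \<C>: "\<C> = (\<lambda>k. (\<chi> i. if i = j then c k else fst B $ i,
                 \<chi> i. if i = j then c (Suc k) else snd B $ i)) ` {..<m}"
    using assms unfolding box_split_def by blast
  show "finite \<C>" by (simp add: \<C>)
  show "\<exists>C\<in>\<C>. z \<in> pts C" if z: "z \<in> pts B" for z
  proof -
    \<comment> \<open>The cuts are read as a list of breakpoints, and
      \<open>segments_at_nonempty\<close> finds the piece containing coordinate j of z.\<close>
    have "hd (map c [0..<Suc m]) \<le> z $ j" "z $ j \<le> last (map c [0..<Suc m])"
      using z c by (auto simp: mem_pts hd_map hd_append last_map)
    then obtain k where "k \<in> segments_at (map c [0..<Suc m]) (z $ j)"
      using segments_at_nonempty[of "map c [0..<Suc m]" "z $ j"] m by auto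
    then have "k < m" "c k \<le> z $ j" "z $ j \<le> c (Suc k)"
      by (auto simp: segments_at_def simp del: upt_Suc)
    then show ?thesis using z by (auto simp: \<C> mem_pts intro!: bexI[of _ k])
  qed
  show "is_node G C \<and> pts C \<subseteq> pts B" if B: "is_node G B" and C: "C \<in> \<C>"
  proof -
    obtain k where k: "k < m" "C = (\<chi> i. if i = j then c k else fst B $ i,
                 \<chi> i. if i = j then c (Suc k) else snd B $ i)"
      using C \<C> by auto
    have "c 0 \<le> c k" "c (Suc k) \<le> c m" "c k < c (Suc k)"
      using box_split_cuts[OF c(3)] c(3) k(1) by auto
    then have cuts: "fst B $ j \<le> c k" "c (Suc k) \<le> snd B $ j" using c by auto
    have "pts C \<subseteq> pts B"
    proof
      fix z assume "z \<in> pts C"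
      then have z: "fst C $ i \<le> z $ i" "z $ i \<le> snd C $ i" for i by (auto simp: mem_pts)
      have "fst B $ i \<le> z $ i \<and> z $ i \<le> snd B $ i" for i
        using z[of i] cuts by (cases "i = j") (auto simp: k(2))
      then show "z \<in> pts B" by (simp add: mem_pts)
    qed
    then show ?thesis
      using B \<open>c k < c (Suc k)\<close> by (auto simp: is_node_def k(2))
  qed
qed

lemma box_split_exists:
  assumes "is_node G B"
  shows "\<exists>\<C>. box_split B \<C>"
proof -
  \<comment> \<open>An arbitrary coordinate is bisected.\<close>
  fix j :: 'b
  define d where "d = (snd B $ j - fst B $ j) / 2"
  define c where "c k = fst B $ j + real k * d" for k
  have "0 < d" using node_less[OF assms, of j] by (simp add: d_def)
  then have "c k < c (Suc k)" for k by (simp add: c_def algebra_simps)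
  then show ?thesis
    unfolding box_split_def by (intro exI[of _ j] exI[of _ 2] exI[of _ c] exI conjI refl)
      (auto simp: c_def d_def field_simps)
qed

section \<open>The invariant of a run\<close>

text \<open>The slack is \<open>solver_above\<close> because a reported optimum may exceed the true
  one by that much. The property passes to subboxes with the same bound, as branching
  requires.\<close>

definition bound_valid :: "('n::finite, 'd::finite) gp \<Rightarrow> bb_params \<Rightarrow> 'd active_node \<Rightarrow> bool" where
  "bound_valid G P a \<longleftrightarrow> is_node G (node_box a)
     \<and> (\<forall>z\<in>pts (node_box a). bound a \<le> ereal (post_mean G z + solver_above P))"

text \<open>Records what the solution of a node problem leaves behind: its breakpoints and a
  candidate point whose value is no better than the upper bound u. It survives later improvements of
  the incumbent by \<open>bound_tight_mono\<close>.\<close>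

definition bound_tight ::
  "('n::finite, 'd::finite) gp \<Rightarrow> bb_params \<Rightarrow> ereal \<Rightarrow> 'd active_node \<Rightarrow> bool" where
  "bound_tight G P u a \<longleftrightarrow> (\<exists>lb \<eta> x. bound a = ereal lb
     \<and> node_breakpoints G (threshold P) (node_box a) \<eta>
     \<and> palm_LB G (threshold P) (node_box a) \<eta> - solver_below P \<le> lb
     \<and> x \<in> pts (node_box a) \<and> u \<le> ereal (post_mean G x))"

lemma bound_tight_mono: "bound_tight G P u a \<Longrightarrow> v \<le> u \<Longrightarrow> bound_tight G P v a"
  unfolding bound_tight_def using order_trans by blast

text \<open>A point leaves the active boxes only by fathoming, and the second alternative is what
  the fathoming test then guarantees. It persists because the upper bound never increases.\<close>

definition covered :: "('n::finite, 'd::finite) gp \<Rightarrow> bb_params \<Rightarrow> 'd bb_state \<Rightarrow> real ^ 'd \<Rightarrow> bool" where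
  "covered G P s z \<longleftrightarrow> (\<exists>a\<in>active s. z \<in> pts (node_box a))
     \<or> upper_bound G s \<le> ereal (post_mean G z + solver_above P + tol_abs P)"

definition bb_invariant :: "('n::finite, 'd::finite) gp \<Rightarrow> bb_params \<Rightarrow> 'd bb_state \<Rightarrow> bool" where
  "bb_invariant G P s \<longleftrightarrow> finite (active s)
     \<and> (\<forall>a\<in>active s. bound_valid G P a \<and> (solved a \<longrightarrow> bound_tight G P (upper_bound G s) a))
     \<and> (\<forall>x. incumbent s = Some x \<longrightarrow> x \<in> domain G)
     \<and> (\<forall>z\<in>domain G. covered G P s z)"

lemma bb_invariant_init: "bb_init G s \<Longrightarrow> bb_invariant G P s"
  unfolding bb_init_def bb_invariant_def bound_valid_def covered_def by fastforce

lemma bb_invariant_solve_step: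
  assumes G: "valid_gp G" and step: "solve_step G P s s'" and inv: "bb_invariant G P s"
  shows "bb_invariant G P s'"
proof -
  obtain a \<eta> lb xh where a: "a \<in> active s" "\<not> solved a"
    and bps: "node_breakpoints G (threshold P) (node_box a) \<eta>"
    and lb: "palm_LB G (threshold P) (node_box a) \<eta> - solver_below P \<le> lb"
      "lb \<le> palm_LB G (threshold P) (node_box a) \<eta> + solver_above P"
    and xh: "xh \<in> pts (node_box a)"
    and s': "s' = \<lparr>active = insert (a\<lparr>solved := True, bound := ereal lb\<rparr>) (active s - {a}),
            incumbent = (if ereal (post_mean G xh) < upper_bound G s then Some xh
                         else incumbent s)\<rparr>"
    using step unfolding solve_step_def node_breakpoints_def by blast
  let ?a = "a\<lparr>solved := True, bound := ereal lb\<rparr>"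
  have act: "active s' = insert ?a (active s - {a})" by (simp add: s')
  have node: "is_node G (node_box a)" using inv a by (auto simp: bb_invariant_def bound_valid_def)
  \<comment> \<open>After the update the incumbent is at least as good as before and as the
    candidate, which therefore witnesses tightness.\<close>
  have ub: "upper_bound G s' \<le> upper_bound G s" "upper_bound G s' \<le> ereal (post_mean G xh)"
    by (auto simp: s' upper_bound_def less_imp_le split: option.splits)
  have "bound_valid G P ?a"
    using node palm_LB_le_post_mean[OF G node bps] lb(2) by (fastforce simp: bound_valid_def)
  moreover have "bound_tight G P (upper_bound G s') ?a"
    using bps lb(1) xh ub(2) by (auto simp: bound_tight_def)
  moreover have "bound_tight G P (upper_bound G s') b" if "b \<in> active s" "solved b" for b
    using that inv bound_tight_mono[OF _ ub(1)] by (auto simp: bb_invariant_def)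
  moreover have "x \<in> domain G" if "incumbent s' = Some x" for x
    using that inv node xh by (auto simp: s' is_node_def bb_invariant_def split: if_splits)
  moreover have "covered G P s' z" if "covered G P s z" for z
    using that order_trans[OF ub(1)] by (auto simp: covered_def act)
  ultimately show ?thesis using inv by (auto simp: bb_invariant_def act)
qed

lemma bb_invariant_fathom_step:
  assumes step: "fathom_step G P s s'" and inv: "bb_invariant G P s"
  shows "bb_invariant G P s'"
proof -
  obtain a where a: "a \<in> active s" "fathomable G P s a" and s': "s' = s\<lparr>active := active s - {a}\<rparr>"
    using step unfolding fathom_step_def by blast
  have ub: "upper_bound G s' = upper_bound G s" by (simp add: s' upper_bound_def)
  have act: "active s' = active s - {a}" by (simp add: s')
  \<comment> \<open>The fathoming test bounds the upper bound by the node bound plus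
    \<open>tol_abs\<close>, and validity bounds the node bound by the mean at z plus
    \<open>solver_above\<close>.\<close>
  have "upper_bound G s \<le> ereal (post_mean G z + solver_above P + tol_abs P)"
    if "z \<in> pts (node_box a)" for z
  proof -
    have "upper_bound G s - ereal (tol_abs P) \<le> ereal (post_mean G z + solver_above P)"
      using a inv that unfolding bb_invariant_def bound_valid_def fathomable_def
      by (meson order_trans)
    then show ?thesis by (cases "upper_bound G s") auto
  qed
  then have "covered G P s' z" if "covered G P s z" for z
    using that unfolding covered_def ub act by blast
  then show ?thesis using inv unfolding bb_invariant_def ub by (auto simp: s')
qed

lemma bb_invariant_branch_step:
  assumes step: "branch_step G P B \<C> s s'" and inv: "bb_invariant G P s"
  shows "bb_invariant G P s'"
proof -
  obtain a where a: "a \<in> active s" "node_box a = B" and split: "box_split B \<C>"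
    and s': "s' = s\<lparr>active := (active s - {a})
                 \<union> (\<lambda>C. \<lparr>node_box = C, solved = False, bound = bound a\<rparr>) ` \<C>\<rparr>"
    using step unfolding branch_step_def by blast
  note pts = box_split_pts[OF split]
  have ub: "upper_bound G s' = upper_bound G s" by (simp add: s' upper_bound_def)
  have valid: "bound_valid G P a" using inv a by (auto simp: bb_invariant_def)
  then have "bound_valid G P \<lparr>node_box = C, solved = False, bound = bound a\<rparr>"
    if "C \<in> \<C>" for C
    using pts(3)[of G, OF _ that] a by (auto simp: bound_valid_def)
  moreover have "covered G P s' z" if "covered G P s z" for z
  proof (cases "z \<in> pts B")
    case True
    then obtain C where "C \<in> \<C>" "z \<in> pts C" using pts(2) by blast
    then show ?thesis unfolding covered_def
      by (intro disjI1 bexI[of _ "\<lparr>node_box = C, solved = False, bound = bound a\<rparr>"]) (auto simp: s')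
  next
    case False
    then show ?thesis using that a unfolding covered_def ub by (auto simp: s')
  qed
  ultimately show ?thesis
    using inv pts(1) unfolding bb_invariant_def ub by (auto simp: s')
qed

lemma bb_invariant_step:
  assumes "valid_gp G" "bb_step G P s s'" "bb_invariant G P s"
  shows "bb_invariant G P s'"
  using assms bb_invariant_solve_step bb_invariant_fathom_step bb_invariant_branch_step
  unfolding bb_step_def by blast

lemma bb_execution_invariant:
  assumes G: "valid_gp G" and exec: "bb_execution G P S T"
  shows "enat n \<le> T \<Longrightarrow> bb_invariant G P (S n)"
proof (induction n)
  case 0
  then show ?case using exec by (simp add: bb_execution_def bb_invariant_init)
next
  case (Suc n)
  then have "enat n < T" by (metis Suc_ile_eq)
  then show ?case
    using Suc.IH exec bb_invariant_step[OF G] unfolding bb_execution_def by (meson less_imp_le)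
qed

text \<open>The reported bound is at least \<open>palm_LB\<close> minus \<open>solver_below\<close>,
  yet, as the node is not fathomable, below the upper bound minus \<open>tol_abs\<close>, which is
  at most the candidate value minus \<open>tol_abs\<close>. The resulting gap does not depend on the
  node.\<close>

lemma branch_step_gap:
  assumes step: "branch_step G P B \<C> s s'" and inv: "bb_invariant G P s"
  shows "is_node G B \<and> (\<exists>\<eta> x. node_breakpoints G (threshold P) B \<eta> \<and> x \<in> pts B
    \<and> tol_abs P - solver_below P \<le> post_mean G x - palm_LB G (threshold P) B \<eta>)"
proof -
  obtain a where a: "a \<in> active s" "node_box a = B" "solved a" "\<not> fathomable G P s a"
    using step unfolding branch_step_def by blast
  then obtain lb \<eta> x where lb: "bound a = ereal lb" "palm_LB G (threshold P) B \<eta> - solver_below P \<le> lb"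
    and bps: "node_breakpoints G (threshold P) B \<eta>"
    and x: "x \<in> pts B" "upper_bound G s \<le> ereal (post_mean G x)"
    using inv unfolding bb_invariant_def bound_tight_def by blast
  have "ereal lb < upper_bound G s - ereal (tol_abs P)"
    using a(4) lb(1) by (simp add: fathomable_def not_le)
  also have "\<dots> \<le> ereal (post_mean G x) - ereal (tol_abs P)"
    using x(2) by (rule ereal_minus_mono) simp
  finally have "lb \<le> post_mean G x - tol_abs P" by simp
  then show ?thesis
    using a inv lb bps x by (intro conjI exI[of _ \<eta>] exI[of _ x])
      (auto simp: bb_invariant_def bound_valid_def)
qed

text \<open>Every box on the branch has a child, so it was itself branched and has the gap of
  \<open>branch_step_gap\<close>. By \<open>palm_LB_converges\<close> this gap tends to 0, against
  \<open>solver_below\<close> < \<open>tol_abs\<close>.\<close>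

lemma no_infinite_branch:
  assumes G: "valid_gp G" and P: "valid_params P" and exec: "bb_execution G P S T"
    and branch: "infinite_branch G P S T b"
    and diam: "(\<lambda>k. diameter (pts (b k))) \<longlonglongrightarrow> 0"
  shows False
proof -
  have gap: "is_node G (b k) \<and> (\<exists>\<eta> x. node_breakpoints G (threshold P) (b k) \<eta> \<and> x \<in> pts (b k)
    \<and> tol_abs P - solver_below P \<le> post_mean G x - palm_LB G (threshold P) (b k) \<eta>)" for k
  proof -
    obtain n \<C> where "enat n < T" "branch_step G P (b k) \<C> (S n) (S (Suc n))"
      using branch unfolding infinite_branch_def child_in_def by blast
    then show ?thesis
      using branch_step_gap bb_execution_invariant[OF G exec, of n] by (meson less_imp_le)
  qed
  then have "\<forall>k. \<exists>\<eta> x. node_breakpoints G (threshold P) (b k) \<eta> \<and> x \<in> pts (b k)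
    \<and> tol_abs P - solver_below P \<le> post_mean G x - palm_LB G (threshold P) (b k) \<eta>"
    by blast
  from choice[OF this] obtain \<eta> where
    "\<forall>k. \<exists>x. node_breakpoints G (threshold P) (b k) (\<eta> k) \<and> x \<in> pts (b k)
    \<and> tol_abs P - solver_below P \<le> post_mean G x - palm_LB G (threshold P) (b k) (\<eta> k)" ..
  from choice[OF this] obtain x where
    bps: "\<And>k. node_breakpoints G (threshold P) (b k) (\<eta> k)" and x: "\<And>k. x k \<in> pts (b k)"
    and le: "\<And>k. tol_abs P - solver_below P
      \<le> post_mean G (x k) - palm_LB G (threshold P) (b k) (\<eta> k)" by blast
  have "(\<lambda>k. post_mean G (x k) - palm_LB G (threshold P) (b k) (\<eta> k)) \<longlonglongrightarrow> 0"
    using gap by (intro palm_LB_converges[OF G _ bps x diam]) blast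
  then have "tol_abs P - solver_below P \<le> 0"
    by (rule LIMSEQ_le_const) (use le in blast)
  then show False using P by (simp add: valid_params_def)
qed

section \<open>Termination and optimality\<close>

lemma mset_set_replace_mult1:
  assumes "finite A" "a \<in> A" "finite N" and less: "\<And>b. b \<in> N \<Longrightarrow> (b, a) \<in> r"
  shows "(mset_set (A - {a} \<union> N), mset_set A) \<in> mult1 r"
proof (rule mult1I)
  show "mset_set A = add_mset a (mset_set (A - {a}))"
    using assms by (simp add: mset_set.remove)
  \<comment> \<open>Elements of N that are already in A - {a} must not be counted twice; only the
    others are added to the multiset.\<close>
  have "A - {a} \<union> N = (A - {a}) \<union> (N - (A - {a}))" by blast
  also have "mset_set \<dots> = mset_set (A - {a}) + mset_set (N - (A - {a}))"
    using assms by (intro mset_set_Union) auto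
  finally show "mset_set (A - {a} \<union> N) = mset_set (A - {a}) + mset_set (N - (A - {a}))" .
  show "(b, a) \<in> r" if "b \<in># mset_set (N - (A - {a}))" for b
    using that less assms by simp
qed

text \<open>Nodes are compared by the child relation on boxes first, then by the flag with True
  below False. Solving keeps the box and sets the flag, fathoming replaces the node by nothing, and
  branching replaces it by children.\<close>

lemma bb_step_mult1:
  assumes step: "bb_step G P (S n) (S (Suc n))" and n: "enat n < T" and fin: "finite (active (S n))"
  shows "(mset_set (active (S (Suc n))), mset_set (active (S n)))
    \<in> mult1 (inv_image ({(C, B). child_in G P S T B C} <*lex*> {(True, False)})
        (\<lambda>a. (node_box a, solved a)))" (is "_ \<in> mult1 ?r")
proof -
  have "\<exists>a N. a \<in> active (S n) \<and> finite N \<and> active (S (Suc n)) = active (S n) - {a} \<union> N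
    \<and> (\<forall>b\<in>N. (b, a) \<in> ?r)"
    using step unfolding bb_step_def
  proof (elim conjE disjE exE)
    assume "solve_step G P (S n) (S (Suc n))"
    then obtain a lb where "a \<in> active (S n)" "\<not> solved a"
      "active (S (Suc n)) = active (S n) - {a} \<union> {a\<lparr>solved := True, bound := ereal lb\<rparr>}"
      unfolding solve_step_def by fastforce
    then show ?thesis
      by (intro exI[of _ a] exI[of _ "{a\<lparr>solved := True, bound := ereal lb\<rparr>}"]) simp
  next
    assume "fathom_step G P (S n) (S (Suc n))"
    then obtain a where "a \<in> active (S n)" "active (S (Suc n)) = active (S n) - {a} \<union> {}"
      unfolding fathom_step_def by auto
    then show ?thesis by blast
  next
    fix B \<C> assume br: "branch_step G P B \<C> (S n) (S (Suc n))" and "\<not> bb_stopped G P (S n)"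
    then have child: "child_in G P S T B C" if "C \<in> \<C>" for C
      using n that unfolding child_in_def by blast
    obtain a where a: "a \<in> active (S n)" "node_box a = B" and split: "box_split B \<C>"
      and S: "S (Suc n) = (S n)\<lparr>active := (active (S n) - {a})
                 \<union> (\<lambda>C. \<lparr>node_box = C, solved = False, bound = bound a\<rparr>) ` \<C>\<rparr>"
      using br unfolding branch_step_def by blast
    show ?thesis
      using a child box_split_pts(1)[OF split]
      by (intro exI[of _ a] exI[of _ "(\<lambda>C. \<lparr>node_box = C, solved = False, bound = bound a\<rparr>) ` \<C>"])
        (auto simp: S)
  qed
  then obtain a N where "a \<in> active (S n)" "finite N" "\<forall>b\<in>N. (b, a) \<in> ?r"
    and eq: "active (S (Suc n)) = active (S n) - {a} \<union> N" by (elim exE conjE)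
  then show ?thesis unfolding eq by (intro mset_set_replace_mult1[OF fin]) blast+
qed

lemma bb_execution_finite:
  fixes G :: "('n::finite, 'd::finite) gp" and S :: "nat \<Rightarrow> 'd bb_state"
  assumes G: "valid_gp G" and exec: "bb_execution G P S T"
    and "\<And>b. \<not> infinite_branch G P S T b"
  shows "T \<noteq> \<infinity>"
proof
  assume T: "T = \<infinity>"
  let ?r = "inv_image ({(C, B). child_in G P S T B C} <*lex*> {(True, False)})
        (\<lambda>a :: 'd active_node. (node_box a, solved a))"
  \<comment> \<open>For the child relation of this run, an infinite descending chain is literally an
    infinite branch.\<close>
  have "wf {(C, B). child_in G P S T B C}"
    using assms(3) by (simp add: wf_iff_no_infinite_down_chain infinite_branch_def)
  moreover have "wf {(True, False)}" by (simp add: wf_insert)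
  ultimately have "wf (mult1 ?r)" by (intro wf_mult1 wf_inv_image wf_lex_prod)
  moreover have "\<exists>f. \<forall>n. (f (Suc n), f n) \<in> mult1 ?r"
    using bb_execution_invariant[OF G exec] exec
    by (intro exI[of _ "\<lambda>n. mset_set (active (S n))"] allI bb_step_mult1)
      (simp_all add: T bb_execution_def bb_invariant_def)
  ultimately show False unfolding wf_iff_no_infinite_down_chain by blast
qed

text \<open>Any active node can be solved, fathomed or branched. With no active node left, the
  invariant forces an incumbent and the gap is 0, so the run has stopped.\<close>

lemma bb_step_exists:
  assumes G: "valid_gp G" and P: "valid_params P" and inv: "bb_invariant G P s"
    and not_stopped: "\<not> bb_stopped G P s"
  shows "\<exists>s'. bb_step G P s s'"
proof (cases "active s = {}")
  case True
  \<comment> \<open>With no active node a point of the domain can be covered only through a finite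
    upper bound.\<close>
  have "dom_lo G \<in> domain G" using G by (auto simp: valid_gp_def domain_def mem_box_cart less_imp_le)
  then have "upper_bound G s \<noteq> \<infinity>" using inv True by (fastforce simp: bb_invariant_def covered_def)
  then obtain x where "incumbent s = Some x" by (cases "incumbent s") (auto simp: upper_bound_def)
  moreover from this have "upper_bound G s - global_lower_bound G s = 0"
    using True by (simp add: global_lower_bound_def upper_bound_def)
  moreover have "0 \<le> gap_tolerance G P x" using P by (auto simp: gap_tolerance_def valid_params_def)
  ultimately have "bb_stopped G P s" by (simp add: bb_stopped_def)
  then show ?thesis using not_stopped by simp
next
  case False
  then obtain a where a: "a \<in> active s" by blast
  then have node: "is_node G (node_box a)" using inv by (auto simp: bb_invariant_def bound_valid_def)
  consider "\<not> solved a" | "fathomable G P s a" | "solved a" "\<not> fathomable G P s a" by blast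
  then show ?thesis
  proof cases
    case 1
    obtain \<eta> where "\<And>i. valid_breakpoints G (node_box a) i (\<eta> i)"
      using valid_breakpoints_exist[OF G node] by metis
    moreover obtain xh where "xh \<in> pts (node_box a)" using pts_nonempty[OF node] by blast
    moreover have "0 \<le> solver_below P" "0 \<le> solver_above P" using P by (auto simp: valid_params_def)
    ultimately have "\<exists>s'. solve_step G P s s'"
      unfolding solve_step_def using a 1
      by (intro exI conjI[rotated -1]) (rule refl, auto)
    then show ?thesis using not_stopped unfolding bb_step_def by blast
  next
    case 2
    then show ?thesis using a not_stopped unfolding bb_step_def fathom_step_def by blast
  next
    case 3
    then show ?thesis
      using a not_stopped box_split_exists[OF node] unfolding bb_step_def branch_step_def by blast
  qed
qed

lemma stopped_incumbent_optimal:
  assumes G: "valid_gp G" and inv: "bb_invariant G P s"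
    and stopped: "bb_stopped G P s" and x: "incumbent s = Some x"
  shows "eps_global_minimizer (post_mean G) (domain G) (gap_tolerance G P x + solver_above P) x"
proof -
  have ub: "upper_bound G s = ereal (post_mean G x)" using x by (simp add: upper_bound_def)
  have gap: "ereal (post_mean G x) - global_lower_bound G s \<le> ereal (gap_tolerance G P x)"
    using stopped x ub by (simp add: bb_stopped_def)
  have "post_mean G x - (gap_tolerance G P x + solver_above P) \<le> post_mean G z" if "z \<in> domain G" for z
  proof -
    have "covered G P s z" using inv that by (simp add: bb_invariant_def)
    then consider a where "a \<in> active s" "z \<in> pts (node_box a)"
      | "upper_bound G s \<le> ereal (post_mean G z + solver_above P + tol_abs P)"
      by (auto simp: covered_def)
    then show ?thesis
    proof cases
      case 1
      have "global_lower_bound G s \<le> bound a"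
        unfolding global_lower_bound_def using inv 1 by (intro Min_le) (auto simp: bb_invariant_def)
      also have "\<dots> \<le> ereal (post_mean G z + solver_above P)"
        using inv 1 by (auto simp: bb_invariant_def bound_valid_def)
      \<comment> \<open>An infinite global lower bound is excluded: -\<infinity> by the finite gap,
        \<infinity> by the real bound just derived.\<close>
      finally show ?thesis using gap by (cases "global_lower_bound G s") auto
    next
      case 2
      \<comment> \<open>\<open>tol_abs\<close> is one of the two arguments of the maximum in
        \<open>gap_tolerance\<close>, so the loss from fathoming is within the tolerance.\<close>
      then show ?thesis by (simp add: ub gap_tolerance_def)
    qed
  qed
  moreover have "domain G \<noteq> {}"
    using G by (auto simp: valid_gp_def domain_def interval_ne_empty_cart less_imp_le)
  ultimately have "post_mean G x - (gap_tolerance G P x + solver_above P) \<le> (INF z\<in>domain G. post_mean G z)"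
    by (intro cINF_greatest)
  moreover have "x \<in> domain G" using inv x by (simp add: bb_invariant_def)
  ultimately show ?thesis by (simp add: eps_global_minimizer_def)
qed

theorem proposition5:
  fixes G :: "('n::finite, 'd::finite) gp"
    and P :: bb_params
    and S :: "nat \<Rightarrow> 'd bb_state"
    and T :: enat
  assumes "valid_gp G"
    and "valid_params P"
    and "bb_execution G P S T"
    and "\<And>b. infinite_branch G P S T b \<Longrightarrow> (\<lambda>k. diameter (pts (b k))) \<longlonglongrightarrow> 0"
  shows "\<exists>n x. T = enat n \<and> bb_stopped G P (S n) \<and> incumbent (S n) = Some x
           \<and> eps_global_minimizer (post_mean G) (domain G)
               (gap_tolerance G P x + solver_above P) x"
proof -
  have "T \<noteq> \<infinity>"
    using bb_execution_finite[OF assms(1,3)] no_infinite_branch[OF assms(1-3)] assms(4) by blast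
  then obtain n where n: "T = enat n" by (cases T) auto
  have inv: "bb_invariant G P (S n)" using bb_execution_invariant[OF assms(1,3)] n by simp
  \<comment> \<open>A finite run ends where no step is possible, and by
    \<open>bb_step_exists\<close> only a stopped state admits none.\<close>
  have stopped: "bb_stopped G P (S n)"
    using bb_step_exists[OF assms(1,2) inv] assms(3) n by (auto simp: bb_execution_def)
  then obtain x where "incumbent (S n) = Some x" by (auto simp: bb_stopped_def)
  then show ?thesis
    using n stopped stopped_incumbent_optimal[OF assms(1) inv stopped] by blast
qed

end
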